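(* Suppose $\mathcal{C}(x_0)\ne\varnothing$. For any $c\in\mathcal{C}(x_0)$ one has $t_p^\pm=t_p^\pm(x_0,c)>0$. There are two cases. (i) Case $\overline{\mathrm D}_-\Phi(x_0)<\underline{\mathrm D}_+\Phi(x_0)$. (a) If $c\in(\overline{\mathrm D}_-\Phi(x_0),\underline{\mathrm D}_+\Phi(x_0))$, then $t_p=t_p^\pm=\infty$. (b) If $c=\overline{\mathrm D}_-\Phi(x_0)\in\mathcal{C}(x_0)$, then $t_p^+=\infty$. Assume that $f''(u)=(N_++o(1))|u-c|^{\alpha_+}$ as $u\to c+$ and $\varphi(x_0+l)-c=(C_{\gamma_-}+o(1))\,\mathrm{sgn}(l)|l|^{\gamma_-}$ as $l\to0-$, for some constants $\alpha_+\ge0$, $\gamma_->0$, $N_+>0$, $C_{\gamma_-}\neq0$. Then $t_p^-\in(0,\infty)$ if and only if $C_{\gamma_-}<0$ and $\gamma_-(1+\alpha_+)=1$. Furthermore, if $t_p^-\in(0,\infty)$, then $t_p^-=\big(\gamma_-N_+|C_{\gamma_-}|^{1+\alpha_+}\big)^{-1}$, and for any $t>t_p^-$, $\Phi(l;x_0,c)<F(l;t,c)$ for small $l<0$. (c) If $c=\underline{\mathrm D}_+\Phi(x_0)\in\mathcal{C}(x_0)$, then $t_p^-=\infty$. Assume that $f''(u)=(N_-+o(1))|u-c|^{\alpha_-}$ as $u\to c-$ and $\varphi(x_0+l)-c=(C_{\gamma_+}+o(1))\,\mathrm{sgn}(l)|l|^{\gamma_+}$ as $l\to0+$, for some constants $\alpha_-\ge0$,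 $\gamma_+>0$, $N_->0$, $C_{\gamma_+}\neq0$. Then $t_p^+\in(0,\infty)$ if and only if $C_{\gamma_+}<0$ and $\gamma_+(1+\alpha_-)=1$. Furthermore, if $t_p^+\in(0,\infty)$, then $t_p^+=\big(\gamma_+N_-|C_{\gamma_+}|^{1+\alpha_-}\big)^{-1}$, and for any $t>t_p^+$, $\Phi(l;x_0,c)<F(l;t,c)$ for small $l>0$. (ii) Case $\overline{\mathrm D}_-\Phi(x_0)=\underline{\mathrm D}_+\Phi(x_0)$. Assume that $f''(u)=(N_\pm+o(1))|u-c|^{\alpha_\pm}$ as $u\to c\pm$ and $\varphi(x_0+l)-c=(C_{\gamma_\pm}+o(1))\,\mathrm{sgn}(l)|l|^{\gamma_\pm}$ as $l\to0\pm$, for some constants $\alpha_\pm\ge0$, $\gamma_\pm>0$, $N_\pm>0$, $C_{\gamma_\pm}\ne0$. Then, for each choice of sign, $t_p^\pm\in(0,\infty)$ if and only if $C_{\gamma_\pm}<0$ and $\gamma_\pm(1+\alpha_\mp)=1$. Furthermore, if $t_p^\pm\in(0,\infty)$, then $t_p^\pm=\big(\gamma_\pm N_\mp|C_{\gamma_\pm}|^{1+\alpha_\mp}\big)^{-1}$, and for any $t>t_p^\pm$, $\Phi(l;x_0,c)<F(l;t,c)$ for small $\pm l>0$.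
   Context: Setting: $f\in C^2(\mathbb{R})$, $f''\ge0$, $\mathcal{L}\{f''=0\}=0$, so $f'$ is strictly increasing; $\varphi\in L^\infty(\mathbb{R})$. For $t>0$: $E(u;x,t)=t\int_0^u f''(s)(\varphi(x-tf'(s))-s)\,ds$, and $\mathcal{U}(x,t)$ is the (nonempty compact) set of maximizers of $E(\cdot\,;x,t)$. $L_c(x_0)=\{(x,t): x=x_0+tf'(c),\ t>0\}$; $\mathcal{C}(x_0)=\{c\in\mathbb{R}: c\in\mathcal{U}(x,t)\text{ for some }(x,t)\in L_c(x_0)\}$. $\Phi(x)=\int_0^x\varphi\,d\xi$, $\overline{\mathrm D}_-\Phi(x_0)=\limsup_{l\to0-}\frac1l\int_{x_0}^{x_0+l}\varphi\,d\xi$, $\underline{\mathrm D}_+\Phi(x_0)=\liminf_{l\to0+}\frac1l\int_{x_0}^{x_0+l}\varphi\,d\xi$. $\Phi(l;x_0,c)=\int_{x_0}^{x_0+l}(\varphi(\xi)-c)\,d\xi$; $F(l;t,c)=-t\int_c^{u(l;t,c)}(s-c)f''(s)\,ds$ with $u(l;t,c)=(f')^{-1}(f'(c)-l/t)$ (defined for small $|l|$). Upper bound of lifespan of the characteristic $L_c(x_0)$, $c\in\mathcal C(x_0)$: $t_p^\pm=t_p^\pm(x_0,c)=\sup\{t>0:\ \Phi(l;x_0,c)>F(l;t,c)\text{ for small }\pm l>0\}\in[0,\infty]$ and $t_p=t_p(x_0,c)=\min\{t_p^+,t_p^-\}$. "For small $\pm l>0$" means for all $l$ with $0<\pm l<l_0$,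 for some $l_0>0$. *)

theory Defs
  imports "HOL-Analysis.Analysis"
begin

definition C2 :: "(real \<Rightarrow> real) \<Rightarrow> bool" where
  "C2 f \<longleftrightarrow> (\<forall>x. f field_differentiable at x) \<and>
          (\<forall>x. deriv f field_differentiable at x) \<and>
          continuous_on UNIV (deriv (deriv f))"

text \<open>An element of \<open>L\<^sup>\<infinity>\<close> is given by an arbitrary representative: a Lebesgue measurable,
  essentially bounded function. All integrals below are oriented Lebesgue integrals.\<close>

definition L_infinity :: "(real \<Rightarrow> real) \<Rightarrow> bool" where
  "L_infinity \<phi> \<longleftrightarrow> \<phi> \<in> borel_measurable lebesgue \<and> (\<exists>B. AE x in lebesgue. \<bar>\<phi> x\<bar> \<le> B)"

definition E_fun :: "(real \<Rightarrow> real) \<Rightarrow> (real \<Rightarrow> real) \<Rightarrow> real \<Rightarrow> real \<Rightarrow> real \<Rightarrow> real" where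
  "E_fun f \<phi> u x t =
     t * (LINT s=ereal 0..ereal u|lebesgue. (deriv (deriv f) s * (\<phi> (x - t * deriv f s) - s)))"

definition maximizers :: "(real \<Rightarrow> real) \<Rightarrow> (real \<Rightarrow> real) \<Rightarrow> real \<Rightarrow> real \<Rightarrow> real set" where
  "maximizers f \<phi> x t = {u. \<forall>v. E_fun f \<phi> v x t \<le> E_fun f \<phi> u x t}"

definition char_line :: "(real \<Rightarrow> real) \<Rightarrow> real \<Rightarrow> real \<Rightarrow> (real \<times> real) set" where
  "char_line f c x0 = {(x, t). x = x0 + t * deriv f c \<and> t > 0}"

definition char_set :: "(real \<Rightarrow> real) \<Rightarrow> (real \<Rightarrow> real) \<Rightarrow> real \<Rightarrow> real set" where
  "char_set f \<phi> x0 = {c. \<exists>(x, t) \<in> char_line f c x0. c \<in> maximizers f \<phi> x t}"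

text \<open>The upper left and the lower right Dini derivative at \<open>x0\<close> of a primitive of \<open>\<phi>\<close>.\<close>

definition upper_left_D :: "(real \<Rightarrow> real) \<Rightarrow> real \<Rightarrow> ereal" where
  "upper_left_D \<phi> x0 =
     Limsup (at_left 0) (\<lambda>l. ereal (1 / l * (LINT \<xi>=ereal x0..ereal (x0 + l)|lebesgue. \<phi> \<xi>)))"

definition lower_right_D :: "(real \<Rightarrow> real) \<Rightarrow> real \<Rightarrow> ereal" where
  "lower_right_D \<phi> x0 =
     Liminf (at_right 0) (\<lambda>l. ereal (1 / l * (LINT \<xi>=ereal x0..ereal (x0 + l)|lebesgue. \<phi> \<xi>)))"

definition Phi :: "(real \<Rightarrow> real) \<Rightarrow> real \<Rightarrow> real \<Rightarrow> real \<Rightarrow> real" where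
  "Phi \<phi> l x0 c = (LINT \<xi>=ereal x0..ereal (x0 + l)|lebesgue. (\<phi> \<xi> - c))"

text \<open>The value of \<open>u_fun f l t c\<close> is meaningful only if \<open>deriv f c - l / t\<close> lies in the range of
  \<open>deriv f\<close>. For \<open>t > 0\<close> and strictly increasing continuous \<open>deriv f\<close> this holds for all small
  \<open>\<bar>l\<bar>\<close>, and \<open>F_fun\<close> is only used for such \<open>l\<close>.\<close>

definition u_fun :: "(real \<Rightarrow> real) \<Rightarrow> real \<Rightarrow> real \<Rightarrow> real \<Rightarrow> real" where
  "u_fun f l t c = inv (deriv f) (deriv f c - l / t)"

definition F_fun :: "(real \<Rightarrow> real) \<Rightarrow> real \<Rightarrow> real \<Rightarrow> real \<Rightarrow> real" where
  "F_fun f l t c =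
     - t * (LINT s=ereal c..ereal (u_fun f l t c)|lebesgue. ((s - c) * deriv (deriv f) s))"

text \<open>Suprema are taken in \<open>[0,\<infinity>]\<close>, so the supremum of the empty set is \<open>0\<close>.\<close>

definition tp_plus :: "(real \<Rightarrow> real) \<Rightarrow> (real \<Rightarrow> real) \<Rightarrow> real \<Rightarrow> real \<Rightarrow> ennreal" where
  "tp_plus f \<phi> x0 c =
     Sup {ennreal t | t. t > 0 \<and> (\<forall>\<^sub>F l in at_right 0. Phi \<phi> l x0 c > F_fun f l t c)}"

definition tp_minus :: "(real \<Rightarrow> real) \<Rightarrow> (real \<Rightarrow> real) \<Rightarrow> real \<Rightarrow> real \<Rightarrow> ennreal" where
  "tp_minus f \<phi> x0 c =
     Sup {ennreal t | t. t > 0 \<and> (\<forall>\<^sub>F l in at_left 0. Phi \<phi> l x0 c > F_fun f l t c)}"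

definition tp :: "(real \<Rightarrow> real) \<Rightarrow> (real \<Rightarrow> real) \<Rightarrow> real \<Rightarrow> real \<Rightarrow> ennreal" where
  "tp f \<phi> x0 c = min (tp_plus f \<phi> x0 c) (tp_minus f \<phi> x0 c)"

text \<open>\<open>f''(u) = (N + o(1)) |u - c|\<^sup>\<alpha>\<close> along the filter \<open>G\<close>, which is \<open>at_left c\<close> or
  \<open>at_right c\<close>.\<close>

definition flux_asymp :: "(real \<Rightarrow> real) \<Rightarrow> real \<Rightarrow> real filter \<Rightarrow> real \<Rightarrow> real \<Rightarrow> bool" where
  "flux_asymp f c G N \<alpha> \<longleftrightarrow>
     (\<exists>r. (r \<longlongrightarrow> 0) G \<and> (\<forall>\<^sub>F u in G. deriv (deriv f) u = (N + r u) * \<bar>u - c\<bar> powr \<alpha>))"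

text \<open>\<open>\<phi>(x0 + l) - c = (C + o(1)) sgn(l) |l|\<^sup>\<gamma>\<close> along the filter \<open>G\<close>, which is \<open>at_left 0\<close> or
  \<open>at_right 0\<close>. As \<open>\<phi>\<close> is only determined almost everywhere, this is required of some
  representative \<open>\<psi>\<close> of its class.\<close>

definition data_asymp ::
    "(real \<Rightarrow> real) \<Rightarrow> real \<Rightarrow> real \<Rightarrow> real filter \<Rightarrow> real \<Rightarrow> real \<Rightarrow> bool" where
  "data_asymp \<phi> x0 c G C \<gamma> \<longleftrightarrow>
     (\<exists>\<psi> r. (AE x in lebesgue. \<psi> x = \<phi> x) \<and> (r \<longlongrightarrow> 0) G \<and>
            (\<forall>\<^sub>F l in G. \<psi> (x0 + l) - c = (C + r l) * sgn l * \<bar>l\<bar> powr \<gamma>))"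

end

theory Submission
  imports Defs
begin

text \<open>With \<open>l = t (f'(c) - f'(u))\<close>, the substitution \<open>\<xi> = x - t f'(s)\<close> turns \<open>E(u) - E(c)\<close> at a point
  of the characteristic into \<open>F(l;t,c) - \<Phi>(l;x\<^sub>0,c)\<close>, so \<open>c\<close> is a maximizer iff \<open>\<Phi> \<ge> F\<close> for all
  admissible \<open>l\<close>. Moreover \<open>F(l;t,c)\<close> is the minimum over \<open>v\<close> of
  \<open>t (f(v) - f(c) - f'(c)(v - c)) + l (v - c)\<close>; hence \<open>F\<close> is nonpositive, strictly increasing in \<open>t\<close>
  and \<open>o(l)\<close>. This gives positivity of the lifespan and the comparison of \<open>c\<close> with the Dini
  derivatives. Under the power-law assumptions \<open>\<Phi>\<close> is asymptotic to
  \<open>C |l|\<^bsup>\<gamma>+1\<^esup> / (\<gamma>+1)\<close> and \<open>F\<close> to \<open>-(t N \<beta>)\<^bsup>-\<beta>\<^esup> |l|\<^bsup>\<beta>+1\<^esup> / (\<beta>+1)\<close> with \<open>\<beta> = 1/(1+\<alpha>)\<close>; comparing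
  exponents, and for \<open>\<gamma> = \<beta>\<close> the coefficients, yields the lifespan.\<close>

section \<open>Oriented Lebesgue integrals\<close>

text \<open>The oriented integral runs over the open interval, whose missing endpoints are
  negligible. This gives access to substitution and to the fundamental theorem for
  \<open>integral\<close>.\<close>

lemma interval_lebesgue_integral_eq_integral:
  fixes h :: "real \<Rightarrow> real"
  assumes "h absolutely_integrable_on {a..b}" and "a \<le> b"
  shows "(LINT x=ereal a..ereal b|lebesgue. h x) = integral {a..b} h"
    and "(LINT x=ereal b..ereal a|lebesgue. h x) = - integral {a..b} h"
proof -
  have "h absolutely_integrable_on {a<..<b}"
    by (rule set_integrable_subset[OF assms(1)]) auto
  then have "(LINT x:{a<..<b}|lebesgue. h x) = integral {a<..<b} h"
    by (rule set_lebesgue_integral_eq_integral)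
  also have "\<dots> = integral {a..b} h" by (simp add: integral_open_interval_real)
  finally have *: "(LINT x:{a<..<b}|lebesgue. h x) = integral {a..b} h" .
  show "(LINT x=ereal a..ereal b|lebesgue. h x) = integral {a..b} h"
    using * assms(2) by (simp add: interval_lebesgue_integral_def)
  show "(LINT x=ereal b..ereal a|lebesgue. h x) = - integral {a..b} h"
    \<comment> \<open>For \<open>a = b\<close> the definition takes its branch without the minus
      sign; both sides are then 0.\<close>
    using * assms(2) by (cases "a = b") (simp_all add: interval_lebesgue_integral_def set_lebesgue_integral_def)
qed

text \<open>In each of the six orderings of the three points the claim amounts to joining two
  adjacent intervals.\<close>

lemma interval_lebesgue_integral_lebesgue_diff:
  fixes h :: "real \<Rightarrow> real"
  assumes int: "\<And>a b. h absolutely_integrable_on {a..b}"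
  shows "(LINT x=ereal a..ereal c|lebesgue. h x) - (LINT x=ereal a..ereal b|lebesgue. h x)
    = (LINT x=ereal b..ereal c|lebesgue. h x)"
proof -
  note I = interval_lebesgue_integral_eq_integral[OF int]
  have hk: "h integrable_on {a..b}" for a b
    using int set_lebesgue_integral_eq_integral(1) by blast
  note C = Henstock_Kurzweil_Integration.integral_combine[OF _ _ hk]
  consider "a \<le> b" "b \<le> c" | "a \<le> c" "c \<le> b" | "b \<le> a" "a \<le> c" | "b \<le> c" "c \<le> a"
    | "c \<le> a" "a \<le> b" | "c \<le> b" "b \<le> a"
    by linarith
  then show ?thesis
  proof cases
    case 1 then show ?thesis using C[of a b c] by (simp add: I)
  next
    case 2 then show ?thesis using C[of a c b] by (simp add: I)
  next
    case 3 then show ?thesis using C[of b a c] by (simp add: I)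
  next
    case 4 then show ?thesis using C[of b c a] by (simp add: I)
  next
    case 5 then show ?thesis using C[of c a b] by (simp add: I)
  next
    case 6 then show ?thesis using C[of c b a] by (simp add: I)
  qed
qed

section \<open>Integrals of the initial data and the asymptotics of \<open>Phi\<close>\<close>

lemma L_infinity_absolutely_integrable:
  assumes "L_infinity \<phi>"
  shows "\<phi> absolutely_integrable_on {a..b}"
proof -
  from assms obtain B where meas: "\<phi> \<in> borel_measurable lebesgue"
    and B: "AE x in lebesgue. \<bar>\<phi> x\<bar> \<le> B" by (auto simp: L_infinity_def)
  have "integrable lebesgue (\<lambda>x. indicator {a..b} x *\<^sub>R B)"
    using absolutely_integrable_on_const[of "{a..b}" B] by (simp add: set_integrable_def)
  moreover have "(\<lambda>x. indicator {a..b} x *\<^sub>R \<phi> x) \<in> borel_measurable lebesgue"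
    using meas by (intro borel_measurable_scaleR borel_measurable_indicator) auto
  moreover have "AE x in lebesgue. norm (indicator {a..b} x *\<^sub>R \<phi> x) \<le> norm (indicator {a..b} x *\<^sub>R B)"
    using B by eventually_elim (auto simp: indicator_def)
  ultimately show ?thesis unfolding set_integrable_def by (rule Bochner_Integration.integrable_bound)
qed

text \<open>The substitution \<xi> = x0 + \<sigma> \<eta> moves both signs of \<open>l\<close> to
  the interval \<open>{0..h}\<close> with \<open>h\<close> = |l|, so that one argument serves both
  sides.\<close>

lemma Phi_eq_integral:
  assumes int: "\<And>a b. \<phi> absolutely_integrable_on {a..b}"
    and \<sigma>: "\<sigma> = 1 \<or> \<sigma> = -1" and "h \<ge> 0"
  shows "(\<lambda>\<eta>. \<phi> (x0 + \<sigma> * \<eta>) - c) absolutely_integrable_on {0..h}"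
    and "Phi \<phi> (\<sigma> * h) x0 c = \<sigma> * integral {0..h} (\<lambda>\<eta>. \<phi> (x0 + \<sigma> * \<eta>) - c)"
proof -
  let ?g = "\<lambda>\<eta>. x0 + \<sigma> * \<eta>" and ?d = "\<lambda>\<xi>. \<phi> \<xi> - c"
  have d: "?d absolutely_integrable_on {a..b}" for a b
    using int by (intro set_integral_diff absolutely_integrable_on_const) auto
  have img: "?g ` {0..h} = {min x0 (x0 + \<sigma> * h)..max x0 (x0 + \<sigma> * h)}"
    using \<sigma> \<open>h \<ge> 0\<close> by (auto simp: image_iff min_def max_def intro!: bexI[of _ "(_ - x0) / \<sigma>"])
  have abs: "\<bar>\<sigma>\<bar> = 1" using \<sigma> by auto
  have "(\<lambda>\<eta>. \<bar>\<sigma>\<bar> * ?d (?g \<eta>)) absolutely_integrable_on {0..h}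
      \<and> integral {0..h} (\<lambda>\<eta>. \<bar>\<sigma>\<bar> * ?d (?g \<eta>)) = integral (?g ` {0..h}) ?d"
    using \<sigma> d by (subst has_absolute_integral_change_of_variables_1')
      (auto simp: img inj_on_def intro!: derivative_eq_intros)
  then show "(\<lambda>\<eta>. \<phi> (x0 + \<sigma> * \<eta>) - c) absolutely_integrable_on {0..h}"
    and "Phi \<phi> (\<sigma> * h) x0 c = \<sigma> * integral {0..h} (\<lambda>\<eta>. \<phi> (x0 + \<sigma> * \<eta>) - c)"
    using \<sigma> \<open>h \<ge> 0\<close> interval_lebesgue_integral_eq_integral[OF d]
    by (auto simp: img abs Phi_def)
qed

text \<open>\<open>data_asymp\<close> may speak of another representative of the class of
  \<open>\<phi>\<close>; integrals do not see the null set where the two differ.\<close>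

lemma Phi_cong_AE:
  assumes "AE x in lebesgue. \<psi> x = \<phi> x" and int: "\<And>a b. \<phi> absolutely_integrable_on {a..b}"
  shows "\<psi> absolutely_integrable_on {a..b}" and "Phi \<psi> l x0 c = Phi \<phi> l x0 c"
proof -
  obtain S where S: "negligible S" "\<And>x. x \<notin> S \<Longrightarrow> \<psi> x = \<phi> x"
    using assms(1) by (auto elim!: AE_E3 simp: negligible_iff_null_sets)
  have \<psi>: "\<psi> absolutely_integrable_on {a..b}" for a b
    by (rule absolutely_integrable_spike[OF int S(1)]) (use S in auto)
  then show "\<psi> absolutely_integrable_on {a..b}" .
  have eq: "integral {a..b} (\<lambda>x. \<psi> x - c) = integral {a..b} (\<lambda>x. \<phi> x - c)" for a b
    by (rule integral_spike[OF S(1)]) (use S in auto)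
  have d: "(\<lambda>x. \<psi> x - c) absolutely_integrable_on {a..b}" "(\<lambda>x. \<phi> x - c) absolutely_integrable_on {a..b}" for a b
    using int \<psi> by (auto intro!: set_integral_diff absolutely_integrable_on_const)
  show "Phi \<psi> l x0 c = Phi \<phi> l x0 c"
    by (cases "l \<ge> 0") (simp_all add: Phi_def interval_lebesgue_integral_eq_integral d eq)
qed

text \<open>The pointwise error bound \<open>e * \<eta> powr \<gamma>\<close> integrates to
  \<open>e * (h powr (\<gamma> + 1) / (\<gamma> + 1))\<close>, which has the order of the main term
  with an arbitrarily small factor.\<close>

lemma tendsto_Phi:
  assumes int: "\<And>a b. \<phi> absolutely_integrable_on {a..b}"
    and \<sigma>: "\<sigma> = 1 \<or> \<sigma> = -1" and "\<gamma> > 0"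
    and data: "data_asymp \<phi> x0 c (filtermap ((*) \<sigma>) (at_right 0)) C \<gamma>"
  shows "((\<lambda>h. Phi \<phi> (\<sigma> * h) x0 c / h powr (\<gamma> + 1)) \<longlongrightarrow> C / (\<gamma> + 1)) (at_right 0)"
proof -
  from data obtain \<psi>0 r where ae0: "AE x in lebesgue. \<psi>0 x = \<phi> x"
    and r: "((\<lambda>h. r (\<sigma> * h)) \<longlongrightarrow> 0) (at_right 0)"
    and ev0: "\<forall>\<^sub>F h in at_right 0. \<psi>0 (x0 + \<sigma> * h) - c
        = (C + r (\<sigma> * h)) * sgn (\<sigma> * h) * \<bar>\<sigma> * h\<bar> powr \<gamma>"
    unfolding data_asymp_def filterlim_filtermap eventually_filtermap by blast
  \<comment> \<open>With the value \<open>c\<close> at \<open>x0\<close> the error bound also holds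
    at \<eta> = 0, hence on all of the closed interval \<open>{0..h}\<close>.\<close>
  define \<psi> where "\<psi> = \<psi>0(x0 := c)"
  have "AE x in lebesgue. x \<noteq> x0"
    using AE_lborel_singleton[of x0] AE_completion by blast
  with ae0 have ae: "AE x in lebesgue. \<psi> x = \<phi> x"
    by eventually_elim (simp add: \<psi>_def)
  have ev: "\<forall>\<^sub>F h in at_right 0. \<psi> (x0 + \<sigma> * h) - c
        = (C + r (\<sigma> * h)) * sgn (\<sigma> * h) * \<bar>\<sigma> * h\<bar> powr \<gamma>"
    using ev0 eventually_at_right_less[of 0] by eventually_elim (use \<sigma> in \<open>auto simp: \<psi>_def\<close>)
  note \<psi> = Phi_cong_AE[OF ae int]
  note P = Phi_eq_integral[where \<phi> = \<psi>, OF \<psi>(1) \<sigma>]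
  show ?thesis
  proof (rule tendstoI)
    fix e :: real assume "e > 0"
    have "\<forall>\<^sub>F h in at_right 0. dist (r (\<sigma> * h)) 0 < e" by (rule tendstoD[OF r \<open>e > 0\<close>])
    with ev have "\<forall>\<^sub>F h in at_right 0.
        \<bar>\<sigma> * (\<psi> (x0 + \<sigma> * h) - c) - C * h powr \<gamma>\<bar> \<le> e * h powr \<gamma>"
      using eventually_at_right_less[of 0]
    proof eventually_elim
      case (elim h)
      \<comment> \<open>Here \<open>\<sigma> * sgn (\<sigma> * h) = 1\<close>: the orientation
        factor of the integral cancels the sign in the data.\<close>
      then have "\<sigma> * (\<psi> (x0 + \<sigma> * h) - c) - C * h powr \<gamma> = r (\<sigma> * h) * h powr \<gamma>"
        using \<sigma> by (auto simp: sgn_mult algebra_simps)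
      then show ?case using elim by (auto simp: abs_mult intro!: mult_right_mono)
    qed
    then obtain d where "d > 0" and d: "\<And>h. 0 < h \<Longrightarrow> h < d \<Longrightarrow>
        \<bar>\<sigma> * (\<psi> (x0 + \<sigma> * h) - c) - C * h powr \<gamma>\<bar> \<le> e * h powr \<gamma>"
      unfolding eventually_at_right_field by auto
    have "\<forall>\<^sub>F h in at_right 0. 0 < h \<and> h < d"
      using \<open>d > 0\<close> by (auto simp: eventually_at_right_field)
    then show "\<forall>\<^sub>F h in at_right 0.
        dist (Phi \<phi> (\<sigma> * h) x0 c / h powr (\<gamma> + 1)) (C / (\<gamma> + 1)) < e"
    proof eventually_elim
      case (elim h)
      let ?q = "\<lambda>\<eta>. \<sigma> * (\<psi> (x0 + \<sigma> * \<eta>) - c)"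
      have pw: "((\<lambda>\<eta>. \<eta> powr \<gamma>) has_integral (h powr (\<gamma> + 1) / (\<gamma> + 1))) {0..h}"
        using elim \<open>\<gamma> > 0\<close> has_integral_powr_from_0[of \<gamma> h] by simp
      have q: "?q integrable_on {0..h}"
        using elim by (intro integrable_on_mult_right set_lebesgue_integral_eq_integral(1) P(1)) simp
      have Phi: "Phi \<phi> (\<sigma> * h) x0 c = integral {0..h} ?q"
        using P(2)[of h] elim by (simp add: \<psi>)
      have "norm (integral {0..h} (\<lambda>\<eta>. ?q \<eta> - C * \<eta> powr \<gamma>)) \<le> integral {0..h} (\<lambda>\<eta>. e * \<eta> powr \<gamma>)"
      proof (rule integral_norm_bound_integral)
        show "(\<lambda>\<eta>. ?q \<eta> - C * \<eta> powr \<gamma>) integrable_on {0..h}"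
          by (rule integrable_diff[OF q integrable_on_mult_right[OF has_integral_integrable[OF pw]]])
        show "(\<lambda>\<eta>. e * \<eta> powr \<gamma>) integrable_on {0..h}"
          using pw by (intro integrable_on_mult_right) auto
        show "norm (?q \<eta> - C * \<eta> powr \<gamma>) \<le> e * \<eta> powr \<gamma>" if "\<eta> \<in> {0..h}" for \<eta>
          using d[of \<eta>] that elim \<open>\<gamma> > 0\<close> by (cases "\<eta> = 0") (auto simp: \<psi>_def)
      qed
      then have "\<bar>Phi \<phi> (\<sigma> * h) x0 c - C * (h powr (\<gamma> + 1) / (\<gamma> + 1))\<bar> \<le> e * (h powr (\<gamma> + 1) / (\<gamma> + 1))"
        unfolding Phi using q pw
        by (subst (asm) Henstock_Kurzweil_Integration.integral_diff)
          (auto simp: integral_unique intro: integrable_on_mult_right)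
      moreover have "h powr (\<gamma> + 1) > 0" using elim by simp
      \<comment> \<open>The factor 1 / (\<gamma> + 1) < 1 makes the final estimate strict.\<close>
      moreover have "e * (h powr (\<gamma> + 1) / (\<gamma> + 1)) < e * h powr (\<gamma> + 1)"
        using elim \<open>e > 0\<close> \<open>\<gamma> > 0\<close> by (intro mult_strict_left_mono) (auto simp: field_simps)
      ultimately have "\<bar>Phi \<phi> (\<sigma> * h) x0 c - C * (h powr (\<gamma> + 1) / (\<gamma> + 1))\<bar> / h powr (\<gamma> + 1) < e"
        by (subst pos_divide_less_eq) auto
      also have "\<bar>Phi \<phi> (\<sigma> * h) x0 c - C * (h powr (\<gamma> + 1) / (\<gamma> + 1))\<bar> / h powr (\<gamma> + 1)
          = \<bar>(Phi \<phi> (\<sigma> * h) x0 c - C * (h powr (\<gamma> + 1) / (\<gamma> + 1))) / h powr (\<gamma> + 1)\<bar>"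
        by simp
      finally show ?case using elim by (simp add: dist_real_def diff_divide_distrib)
    qed
  qed
qed

section \<open>Strict monotonicity of \<open>deriv f\<close> and strict convexity of
  \<open>f\<close>\<close>

locale strictly_convex_flux =
  fixes f :: "real \<Rightarrow> real"
  assumes C2: "C2 f"
    and nonneg: "\<And>s. deriv (deriv f) s \<ge> 0"
    and null: "{s. deriv (deriv f) s = 0} \<in> null_sets lebesgue"
begin

lemma f_DERIV: "(f has_real_derivative deriv f x) (at x within S)"
  using C2 by (metis C2_def DERIV_deriv_iff_field_differentiable has_field_derivative_at_within)

lemma f'_DERIV: "(deriv f has_real_derivative deriv (deriv f) x) (at x within S)"
  using C2 by (metis C2_def DERIV_deriv_iff_field_differentiable has_field_derivative_at_within)

lemma f''_cont: "continuous_on S (deriv (deriv f))"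
  using C2 by (meson C2_def continuous_on_subset subset_UNIV)

lemma f'_cont: "continuous_on S (deriv f)"
  by (meson f'_DERIV DERIV_continuous_on)

lemma f'_mono: "a \<le> b \<Longrightarrow> deriv f a \<le> deriv f b"
  using DERIV_nonneg_imp_nondecreasing[of a b "deriv f"] f'_DERIV nonneg by blast

text \<open>Equal values at \<open>a < b\<close> would make the monotone \<open>deriv f\<close>
  constant in between, so the second derivative would vanish on a nonempty open interval, which is
  not a null set.\<close>

lemma f'_strict_mono: assumes "a < b" shows "deriv f a < deriv f b"
proof (rule ccontr)
  assume "\<not> deriv f a < deriv f b"
  with f'_mono[of a b] assms have eq: "deriv f a = deriv f b" by simp
  have "deriv (deriv f) s = 0" if "s \<in> {a<..<b}" for s
  proof -
    have "deriv f y = deriv f b" if "y \<in> {a<..<b}" for y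
      using f'_mono[of a y] f'_mono[of y b] that eq by simp
    then have "(deriv f has_real_derivative 0) (at s)"
      using \<open>s \<in> _\<close> by (intro has_field_derivative_transform_within_open[OF DERIV_const, of "{a<..<b}"]) auto
    then show ?thesis using DERIV_unique f'_DERIV by blast
  qed
  then have "{a<..<b} \<subseteq> {s. deriv (deriv f) s = 0}" by auto
  then have "negligible {a<..<b}"
    using null negligible_subset negligible_iff_null_sets by blast
  then show False using open_not_negligible[of "{a<..<b}"] assms by simp
qed

lemma f'_less_iff: "deriv f a < deriv f b \<longleftrightarrow> a < b"
  using f'_strict_mono[of a b] f'_mono[of b a] by linarith

lemma f'_inj: "inj (deriv f)"
  by (rule injI) (metis f'_less_iff less_irrefl linorder_neqE)

text \<open>By the mean value theorem the secant slope is a value of \<open>deriv f\<close> at an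
  intermediate point, to which monotonicity applies.\<close>

lemma tangent_le: "f u + deriv f u * (v - u) \<le> f v"
proof (cases u v rule: linorder_cases)
  case less
  then obtain z where "z > u" "z < v" "f v - f u = (v - u) * deriv f z"
    using MVT2[of u v f "deriv f"] f_DERIV by blast
  then show ?thesis using f'_mono[of u z] less mult_left_mono[of "deriv f u" "deriv f z" "v - u"]
    by (simp add: algebra_simps)
next
  case greater
  then obtain z where "z > v" "z < u" "f u - f v = (u - v) * deriv f z"
    using MVT2[of v u f "deriv f"] f_DERIV by blast
  then show ?thesis using f'_mono[of z u] greater mult_left_mono[of "deriv f z" "deriv f u" "u - v"]
    by (simp add: algebra_simps)
qed simp

text \<open>Chaining the tangent inequality from \<open>u\<close> to the midpoint \<open>m\<close>
  and from \<open>m\<close> to \<open>v\<close> gains a strictly positive term, since the slopes at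
  \<open>u\<close> and \<open>m\<close> differ.\<close>

lemma tangent_less: assumes "u \<noteq> v" shows "f u + deriv f u * (v - u) < f v"
proof -
  define m where "m = (u + v) / 2"
  have "0 < (deriv f m - deriv f u) * (v - m)"
    using assms f'_less_iff[of u m] f'_less_iff[of m u]
    by (cases "u < v") (auto simp: m_def zero_less_mult_iff)
  then show ?thesis using tangent_le[of u m] tangent_le[of m v] by (simp add: algebra_simps)
qed

section \<open>\<open>F_fun\<close> as a minimum and its relation to \<open>E_fun\<close>\<close>

text \<open>Integration by parts: \<open>(s - c) * deriv f s - f s\<close> is a primitive of the
  integrand.\<close>

lemma integral_moment:
  "(LINT s=ereal c..ereal u|lebesgue. ((s - c) * deriv (deriv f) s))
    = (u - c) * deriv f u - f u + f c"
proof -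
  let ?h = "\<lambda>s. (s - c) * deriv (deriv f) s"
  have ai: "?h absolutely_integrable_on {a..b}" for a b
    by (intro absolutely_integrable_continuous_real continuous_intros f''_cont)
  have "((\<lambda>s. (s - c) * deriv f s - f s) has_vector_derivative ?h s) (at s within S)" for s S
    unfolding has_real_derivative_iff_has_vector_derivative[symmetric]
    by (auto intro!: derivative_eq_intros f_DERIV f'_DERIV)
  then have "integral {a..b} ?h = ((b - c) * deriv f b - f b) - ((a - c) * deriv f a - f a)"
    if "a \<le> b" for a b
    using that by (intro integral_unique fundamental_theorem_of_calculus) auto
  then show ?thesis
    by (cases "c \<le> u") (simp_all add: interval_lebesgue_integral_eq_integral[OF ai])
qed

text \<open>Choosing \<open>u\<close> first and computing \<open>l\<close> from it keeps the
  argument of \<open>inv (deriv f)\<close> within the range of \<open>deriv f\<close>.\<close>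

lemma u_fun_eq: "t > 0 \<Longrightarrow> u_fun f (t * (deriv f c - deriv f u)) t c = u"
  by (simp add: u_fun_def inv_f_f[OF f'_inj])

text \<open>Replacing \<open>t * deriv f u\<close> by \<open>t * deriv f c - l\<close> in the closed
  form of the integral makes \<open>l\<close> appear linearly, as in a Legendre transform.\<close>

lemma F_fun_eq:
  assumes "t > 0" and "l = t * (deriv f c - deriv f u)"
  shows "F_fun f l t c = t * (f u - f c - deriv f c * (u - c)) + l * (u - c)"
  using assms unfolding F_fun_def integral_moment
  by (simp add: u_fun_eq) (simp add: algebra_simps)

text \<open>As a function of \<open>v\<close> the right-hand side is convex with derivative
  \<open>t * (deriv f v - deriv f c) + l\<close>, which vanishes at \<open>v = u\<close>; so its
  minimum is the value given by \<open>F_fun_eq\<close>.\<close>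

lemma F_fun_le:
  assumes "t > 0" and l: "l = t * (deriv f c - deriv f u)"
  shows "F_fun f l t c \<le> t * (f v - f c - deriv f c * (v - c)) + l * (v - c)"
proof -
  have "t * (f u + deriv f u * (v - u)) \<le> t * f v"
    using assms(1) tangent_le by (intro mult_left_mono) auto
  then show ?thesis unfolding F_fun_eq[OF assms] unfolding l by (simp add: algebra_simps)
qed

text \<open>Splitting \<open>\<phi> - s\<close> into \<open>(\<phi> - c) - (s - c)\<close> separates
  two integrals from \<open>c\<close> to \<open>u\<close>: the first becomes \<open>- Phi\<close>
  under the substitution \<xi> = X(s), the second yields \<open>F_fun\<close>.\<close>

lemma E_fun_diff:
  assumes "L_infinity \<phi>" and "t > 0" and l: "l = t * (deriv f c - deriv f u)"
  shows "E_fun f \<phi> u (x0 + t * deriv f c) t - E_fun f \<phi> c (x0 + t * deriv f c) t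
    = F_fun f l t c - Phi \<phi> l x0 c"
proof -
  \<comment> \<open>\<open>X s\<close> is the foot at time 0 of the line with speed
    \<open>deriv f s\<close> through the given point; it sends \<open>c\<close> to \<open>x0\<close>
    and \<open>u\<close> to \<open>x0 + l\<close>, and it is decreasing.\<close>
  define X where "X s = x0 + t * deriv f c - t * deriv f s" for s
  define h where "h s = deriv (deriv f) s * (\<phi> (X s) - c)" for s
  define m where "m s = (s - c) * deriv (deriv f) s" for s
  note \<phi> = L_infinity_absolutely_integrable[OF assms(1)]
  have \<phi>c: "(\<lambda>\<xi>. \<phi> \<xi> - c) absolutely_integrable_on {a..b}" for a b
    using \<phi> by (intro set_integral_diff absolutely_integrable_on_const) auto
  have anti: "X b \<le> X a" if "a \<le> b" for a b
    using f'_mono[OF that] \<open>t > 0\<close> by (simp add: X_def)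
  have img: "X ` {a..b} = {X b..X a}" if ab: "a \<le> b" for a b
  proof
    show "X ` {a..b} \<subseteq> {X b..X a}" using anti by auto
    show "{X b..X a} \<subseteq> X ` {a..b}"
    proof
      fix y assume "y \<in> {X b..X a}"
      moreover have "continuous_on {a..b} X"
        unfolding X_def by (intro continuous_intros f'_cont)
      ultimately obtain s where "a \<le> s" "s \<le> b" "X s = y"
        using IVT2'[of X b y a] ab by auto
      then show "y \<in> X ` {a..b}" by auto
    qed
  qed
  \<comment> \<open>The change of variables also delivers the integrability of \<open>h\<close>,
    which involves the composition of the merely measurable \<open>\<phi>\<close> with
    \<open>X\<close>.\<close>
  have cov: "(\<lambda>s. t * h s) absolutely_integrable_on {a..b} \<and>
      integral {a..b} (\<lambda>s. t * h s) = integral {X b..X a} (\<lambda>\<xi>. \<phi> \<xi> - c)" if "a \<le> b" for a b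
  proof -
    have "inj_on X {a..b}"
      using \<open>t > 0\<close> by (auto simp: inj_on_def X_def dest: injD[OF f'_inj])
    moreover have "(X has_real_derivative - t * deriv (deriv f) s) (at s within {a..b})" for s
      unfolding X_def by (auto intro!: derivative_eq_intros f'_DERIV)
    ultimately have "(\<lambda>s. \<bar>- t * deriv (deriv f) s\<bar> * (\<phi> (X s) - c)) absolutely_integrable_on {a..b} \<and>
      integral {a..b} (\<lambda>s. \<bar>- t * deriv (deriv f) s\<bar> * (\<phi> (X s) - c)) = integral {X b..X a} (\<lambda>\<xi>. \<phi> \<xi> - c)"
      by (subst has_absolute_integral_change_of_variables_1') (auto simp: img[OF that] \<phi>c)
    moreover have "\<bar>- t * deriv (deriv f) s\<bar> * (\<phi> (X s) - c) = t * h s" for s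
      using nonneg[of s] \<open>t > 0\<close> by (simp add: h_def abs_mult)
    ultimately show ?thesis by simp
  qed
  have h_ai: "h absolutely_integrable_on {a..b}" for a b
  proof (cases "a \<le> b")
    case True
    then have "(\<lambda>s. (1 / t) * (t * h s)) absolutely_integrable_on {a..b}"
      by (intro set_integrable_mult_right) (use cov in auto)
    then show ?thesis using \<open>t > 0\<close> by simp
  qed (simp add: set_integrable_def)
  have m_ai: "m absolutely_integrable_on {a..b}" for a b
    unfolding m_def by (intro absolutely_integrable_continuous_real continuous_intros f''_cont)
  have hm: "(\<lambda>s. h s - m s) absolutely_integrable_on {a..b}" for a b
    by (intro set_integral_diff h_ai m_ai)
  have key: "t * integral {a..b} (\<lambda>s. h s - m s)
      = integral {X b..X a} (\<lambda>\<xi>. \<phi> \<xi> - c) - t * integral {a..b} m" if "a \<le> b" for a b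
    using cov[OF that]
      Henstock_Kurzweil_Integration.integral_diff[of h "{a..b}" m]
      set_lebesgue_integral_eq_integral(1)[OF h_ai] set_lebesgue_integral_eq_integral(1)[OF m_ai]
    by (simp add: right_diff_distrib)
  have integrand: "deriv (deriv f) s * (\<phi> (x0 + t * deriv f c - t * deriv f s) - s) = h s - m s" for s
    by (simp add: h_def m_def X_def algebra_simps)
  have "E_fun f \<phi> u (x0 + t * deriv f c) t - E_fun f \<phi> c (x0 + t * deriv f c) t
      = t * (LINT s=ereal c..ereal u|lebesgue. (h s - m s))"
    unfolding E_fun_def integrand right_diff_distrib[symmetric]
    using interval_lebesgue_integral_lebesgue_diff[OF hm, of 0 u c] by (simp add: zero_ereal_def)
  also have "\<dots> = - Phi \<phi> l x0 c - t * (LINT s=ereal c..ereal u|lebesgue. m s)"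
  proof -
    have X: "X c = x0" "X u = x0 + l" by (simp_all add: X_def l algebra_simps)
    show ?thesis
    proof (cases "c \<le> u")
      case True
      then show ?thesis using key[OF True] anti[OF True]
        by (simp add: Phi_def interval_lebesgue_integral_eq_integral[OF hm]
            interval_lebesgue_integral_eq_integral[OF m_ai] interval_lebesgue_integral_eq_integral[OF \<phi>c] X)
    next
      case False
      then show ?thesis using key[of u c] anti[of u c]
        by (simp add: Phi_def interval_lebesgue_integral_eq_integral[OF hm]
            interval_lebesgue_integral_eq_integral[OF m_ai] interval_lebesgue_integral_eq_integral[OF \<phi>c] X)
    qed
  qed
  also have "t * (LINT s=ereal c..ereal u|lebesgue. m s) = - F_fun f l t c"
    unfolding F_fun_def m_def using \<open>t > 0\<close> by (simp add: l u_fun_eq)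
  finally show ?thesis by simp
qed

text \<open>At a point of the line where \<open>c\<close> is a maximizer, \<open>E_fun_diff\<close>
  is nonpositive for every \<open>u\<close>, that is, for every \<open>l\<close> reached from some
  \<open>u\<close>.\<close>

lemma char_set_F_le_Phi:
  assumes "L_infinity \<phi>" and "c \<in> char_set f \<phi> x0"
  obtains t where "t > 0"
    and "\<And>u l. l = t * (deriv f c - deriv f u) \<Longrightarrow> F_fun f l t c \<le> Phi \<phi> l x0 c"
proof -
  from assms(2) obtain t where "t > 0" and "c \<in> maximizers f \<phi> (x0 + t * deriv f c) t"
    by (auto simp: char_set_def char_line_def)
  then have "E_fun f \<phi> u (x0 + t * deriv f c) t \<le> E_fun f \<phi> c (x0 + t * deriv f c) t" for u
    by (simp add: maximizers_def)
  then show thesis using that[OF \<open>t > 0\<close>] E_fun_diff[OF assms(1) \<open>t > 0\<close>] by (metis diff_le_0_iff_le)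
qed

end

text \<open>The sign \<open>\<sigma> = \<plusminus>1\<close> selects the side from which \<open>l\<close> tends to 0.\<close>

definition side :: "real \<Rightarrow> real filter" where
  "side \<sigma> = filtermap ((*) \<sigma>) (at_right 0)"

section \<open>Behaviour of \<open>F_fun\<close> as \<open>l\<close> tends to 0\<close>

context strictly_convex_flux
begin

text \<open>The distance \<open>|u - c|\<close> at \<open>l = \<sigma> h\<close> with \<open>h > 0\<close>: a positive \<open>l\<close> pushes \<open>u\<close> below \<open>c\<close>.\<close>

definition gap :: "real \<Rightarrow> real \<Rightarrow> real \<Rightarrow> real \<Rightarrow> real" where
  "gap \<sigma> c t h = \<sigma> * (c - u_fun f (\<sigma> * h) t c)"

text \<open>As soon as \<open>0 < h < t * G e\<close>, the intermediate value theorem solves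
  \<open>t * G z = h\<close> with \<open>z\<close> strictly between 0 and \<open>e\<close>, and
  injectivity of \<open>deriv f\<close> identifies \<open>z\<close> with the gap.\<close>

lemma eventually_gap_less:
  assumes \<sigma>: "\<sigma> = 1 \<or> \<sigma> = -1" and "t > 0" and "e > 0"
  shows "\<forall>\<^sub>F h in at_right 0. 0 < gap \<sigma> c t h \<and> gap \<sigma> c t h < e
    \<and> \<sigma> * h = t * (deriv f c - deriv f (u_fun f (\<sigma> * h) t c))"
proof -
  define G where "G z = \<sigma> * (deriv f c - deriv f (c - \<sigma> * z))" for z
  have mono: "G z < G w \<longleftrightarrow> z < w" for z w
    using \<sigma> f'_less_iff by (auto simp: G_def)
  have cont: "continuous_on {0..e} G"
    unfolding G_def
    by (intro continuous_intros continuous_on_compose2[OF f'_cont[of UNIV]]) auto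
  have "\<forall>\<^sub>F h in at_right 0. 0 < h \<and> h < t * G e"
    using mono[of 0 e] \<open>e > 0\<close> \<open>t > 0\<close> by (auto simp: eventually_at_right_field G_def intro!: exI[of _ "t * G e"])
  then show ?thesis
  proof eventually_elim
    case (elim h)
    then have "G 0 \<le> h / t" "h / t \<le> G e" using \<open>t > 0\<close> by (auto simp: G_def field_simps)
    then obtain z where z: "0 \<le> z" "z \<le> e" "G z = h / t"
      using IVT'[of G 0 "h / t" e] \<open>e > 0\<close> cont by auto
    have "z \<noteq> e" "z \<noteq> 0" using z elim \<open>t > 0\<close> by (auto simp: field_simps G_def)
    have "\<sigma> * h = t * (deriv f c - deriv f (c - \<sigma> * z))"
      using z(3) \<sigma> \<open>t > 0\<close> by (auto simp: G_def field_simps)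
    moreover from this have "u_fun f (\<sigma> * h) t c = c - \<sigma> * z"
      using u_fun_eq[OF \<open>t > 0\<close>] by metis
    ultimately show ?case using z \<open>z \<noteq> e\<close> \<open>z \<noteq> 0\<close> \<sigma> by (auto simp: gap_def)
  qed
qed

lemma eventually_u_fun:
  assumes "\<sigma> = 1 \<or> \<sigma> = -1" and "t > 0"
  shows "\<forall>\<^sub>F l in side \<sigma>. l = t * (deriv f c - deriv f (u_fun f l t c)) \<and> u_fun f l t c \<noteq> c"
  using eventually_gap_less[OF assms zero_less_one, of c]
  unfolding side_def eventually_filtermap
  by eventually_elim (auto simp: gap_def)

lemma filterlim_gap:
  assumes "\<sigma> = 1 \<or> \<sigma> = -1" and "t > 0"
  shows "filterlim (gap \<sigma> c t) (at_right 0) (at_right 0)"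
  unfolding filterlim_at
proof
  show "\<forall>\<^sub>F h in at_right 0. gap \<sigma> c t h \<in> {0<..} \<and> gap \<sigma> c t h \<noteq> 0"
    using eventually_gap_less[OF assms zero_less_one, of c] by eventually_elim auto
  show "(gap \<sigma> c t \<longlongrightarrow> 0) (at_right 0)"
  proof (rule tendstoI)
    fix e :: real assume "e > 0"
    show "\<forall>\<^sub>F h in at_right 0. dist (gap \<sigma> c t h) 0 < e"
      using eventually_gap_less[OF assms \<open>e > 0\<close>, of c] by eventually_elim auto
  qed
qed

lemma tendsto_u_fun:
  assumes "\<sigma> = 1 \<or> \<sigma> = -1" and "t > 0"
  shows "((\<lambda>l. u_fun f l t c) \<longlongrightarrow> c) (side \<sigma>)"
proof -
  have "(gap \<sigma> c t \<longlongrightarrow> 0) (at_right 0)"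
    using filterlim_gap[OF assms, of c] by (simp add: filterlim_at)
  then have "((\<lambda>h. c - \<sigma> * gap \<sigma> c t h) \<longlongrightarrow> c - \<sigma> * 0) (at_right 0)"
    by (intro tendsto_intros)
  moreover have "c - \<sigma> * gap \<sigma> c t h = u_fun f (\<sigma> * h) t c" for h
    using assms(1) by (auto simp: gap_def)
  ultimately show ?thesis by (simp add: side_def filterlim_filtermap)
qed

text \<open>The competitor \<open>v = c\<close> makes the upper bound in \<open>F_fun_le\<close>
  equal to 0.\<close>

lemma eventually_F_fun_nonpos:
  assumes "\<sigma> = 1 \<or> \<sigma> = -1" and "t > 0"
  shows "\<forall>\<^sub>F l in side \<sigma>. F_fun f l t c \<le> 0"
  using eventually_u_fun[OF assms, of c]
  by eventually_elim (use F_fun_le[OF \<open>t > 0\<close>, where v = c] in fastforce)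

text \<open>In \<open>F_fun_eq\<close> the term multiplied by \<open>t\<close> is nonnegative by
  convexity. As \<open>u_fun\<close> tends to \<open>c\<close>, the remaining bound is o(l).\<close>

lemma eventually_F_fun_ge:
  assumes "\<sigma> = 1 \<or> \<sigma> = -1" and "t > 0"
  shows "\<forall>\<^sub>F l in side \<sigma>. F_fun f l t c \<ge> l * (u_fun f l t c - c)"
  using eventually_u_fun[OF assms, of c]
proof eventually_elim
  case (elim l)
  have "0 \<le> t * (f (u_fun f l t c) - f c - deriv f c * (u_fun f l t c - c))"
    using \<open>t > 0\<close> tangent_le[of c "u_fun f l t c"] by (intro mult_nonneg_nonneg) auto
  then show ?case using F_fun_eq[OF \<open>t > 0\<close>, of l c "u_fun f l t c"] elim by linarith
qed

text \<open>The minimizer for time \<open>t\<close> serves as competitor at the smaller time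
  \<open>s\<close>; it differs from \<open>c\<close>, so the term multiplied by the time is strictly
  positive.\<close>

lemma eventually_F_fun_strict_mono:
  assumes "\<sigma> = 1 \<or> \<sigma> = -1" and "0 < s" and "s < t"
  shows "\<forall>\<^sub>F l in side \<sigma>. F_fun f l s c < F_fun f l t c"
proof -
  have "t > 0" using assms by simp
  from eventually_u_fun[OF assms(1,2), of c] eventually_u_fun[OF assms(1) \<open>t > 0\<close>, of c]
  show ?thesis
  proof eventually_elim
    case (elim l)
    let ?v = "u_fun f l t c"
    have "F_fun f l s c \<le> s * (f ?v - f c - deriv f c * (?v - c)) + l * (?v - c)"
      by (rule F_fun_le[OF \<open>0 < s\<close>]) (use elim in blast)
    also have "\<dots> < t * (f ?v - f c - deriv f c * (?v - c)) + l * (?v - c)"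
      using assms tangent_less[of c ?v] elim by (auto intro!: mult_strict_right_mono)
    also have "\<dots> = F_fun f l t c"
      by (rule F_fun_eq[OF \<open>t > 0\<close>, symmetric]) (use elim in blast)
    finally show ?case .
  qed
qed

text \<open>With the gap \<open>z\<close> as parameter, \<open>h = t * G z\<close> and
  \<open>F_fun\<close> equals \<open>t * R z - h * z\<close>. L'Hopital's rule gives the leading
  powers of \<open>G\<close> and \<open>R\<close> at 0, and then \<open>z\<close> is eliminated in
  favour of \<open>h\<close>.\<close>

lemma tendsto_F_fun:
  assumes \<sigma>: "\<sigma> = 1 \<or> \<sigma> = -1" and "t > 0" and "\<alpha> \<ge> 0" and "N > 0"
    and flux: "flux_asymp f c (filtermap (\<lambda>z. c - \<sigma> * z) (at_right 0)) N \<alpha>"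
  defines "\<beta> \<equiv> 1 / (1 + \<alpha>)"
  shows "((\<lambda>h. F_fun f (\<sigma> * h) t c / h powr (\<beta> + 1)) \<longlongrightarrow> - ((t * N * \<beta>) powr - \<beta> / (\<beta> + 1)))
    (at_right 0)"
proof -
  \<comment> \<open>\<open>R\<close> is the tangent remainder of \<open>f\<close> at
    \<open>c\<close>, and \<open>R\<close>, \<open>G\<close> and the second derivative at
    \<open>c - \<sigma> * z\<close> are successive derivatives in \<open>z\<close>.\<close>
  define G where "G z = \<sigma> * (deriv f c - deriv f (c - \<sigma> * z))" for z
  define R where "R z = f (c - \<sigma> * z) - f c + \<sigma> * deriv f c * z" for z
  from flux obtain r where r: "((\<lambda>z. r (c - \<sigma> * z)) \<longlongrightarrow> 0) (at_right 0)"
    and ev: "\<forall>\<^sub>F z in at_right 0. deriv (deriv f) (c - \<sigma> * z)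
        = (N + r (c - \<sigma> * z)) * \<bar>c - \<sigma> * z - c\<bar> powr \<alpha>"
    unfolding flux_asymp_def filterlim_filtermap eventually_filtermap by blast
  have pos: "\<forall>\<^sub>F z in at_right 0. (0::real) < z" by (rule eventually_at_right_less)
  have G': "(G has_real_derivative deriv (deriv f) (c - \<sigma> * z)) (at z)" for z
    unfolding G_def using \<sigma>
    by (auto intro!: derivative_eq_intros DERIV_chain2[OF f'_DERIV])
  have R': "(R has_real_derivative G z) (at z)" for z
    unfolding R_def G_def using \<sigma>
    by (auto intro!: derivative_eq_intros DERIV_chain2[OF f_DERIV])
  have pow': "((\<lambda>z. z powr a) has_real_derivative a * z powr (a - 1)) (at z)" if "z > 0" for a z :: real
    using that by (auto intro!: derivative_eq_intros)
  have pow2: "((\<lambda>z. z powr (\<alpha> + 2)) has_real_derivative (\<alpha> + 2) * z powr (1 + \<alpha>)) (at z)"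
    if "z > 0" for z
    using pow'[OF that, of "\<alpha> + 2"] by (simp add: add.commute)
  have pow0: "((\<lambda>z. z powr a) \<longlongrightarrow> 0) (at_right 0)" if "a > 0" for a :: real
    using that by (intro tendsto_zero_powrI[where b = a] tendsto_intros) (auto intro: eventually_mono[OF pos])
  have G0: "(G \<longlongrightarrow> 0) (at_right 0)" and R0: "(R \<longlongrightarrow> 0) (at_right 0)"
    using DERIV_isCont[OF G', of 0] DERIV_isCont[OF R', of 0]
    by (auto simp: isCont_def G_def R_def filterlim_at_split)
  have limG: "((\<lambda>z. G z / z powr (\<alpha> + 1)) \<longlongrightarrow> N / (\<alpha> + 1)) (at_right 0)"
  proof (rule lhopital_right_0[OF G0 pow0])
    have "((\<lambda>z. (N + r (c - \<sigma> * z)) / (\<alpha> + 1)) \<longlongrightarrow> (N + 0) / (\<alpha> + 1)) (at_right 0)"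
      using \<open>\<alpha> \<ge> 0\<close> by (intro tendsto_intros r) auto
    moreover have "\<forall>\<^sub>F z in at_right 0. (N + r (c - \<sigma> * z)) / (\<alpha> + 1)
        = deriv (deriv f) (c - \<sigma> * z) / ((\<alpha> + 1) * z powr (\<alpha> + 1 - 1))"
      using ev pos by eventually_elim (use \<sigma> in \<open>auto simp: abs_mult\<close>)
    ultimately show "((\<lambda>z. deriv (deriv f) (c - \<sigma> * z) / ((\<alpha> + 1) * z powr (\<alpha> + 1 - 1)))
        \<longlongrightarrow> N / (\<alpha> + 1)) (at_right 0)"
      by (simp add: tendsto_cong)
  qed (use \<open>\<alpha> \<ge> 0\<close> G' in \<open>auto intro!: eventually_mono[OF pos] pow'[of _ "\<alpha> + 1", simplified]\<close>)
  have limR: "((\<lambda>z. R z / z powr (\<alpha> + 2)) \<longlongrightarrow> N / (\<alpha> + 1) / (\<alpha> + 2)) (at_right 0)"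
  proof (rule lhopital_right_0[OF R0 pow0])
    have "((\<lambda>z. G z / z powr (\<alpha> + 1) / (\<alpha> + 2)) \<longlongrightarrow> N / (\<alpha> + 1) / (\<alpha> + 2)) (at_right 0)"
      using \<open>\<alpha> \<ge> 0\<close> by (intro tendsto_intros limG) auto
    then show "((\<lambda>z. G z / ((\<alpha> + 2) * z powr (\<alpha> + 2 - 1))) \<longlongrightarrow> N / (\<alpha> + 1) / (\<alpha> + 2)) (at_right 0)"
      by (simp add: field_simps)
  qed (use \<open>\<alpha> \<ge> 0\<close> R' in \<open>auto intro!: eventually_mono[OF pos] pow2\<close>)
  let ?z = "gap \<sigma> c t"
  note gap = filterlim_gap[OF \<sigma> \<open>t > 0\<close>, of c]
  \<comment> \<open>This is the desired quotient with numerator and denominator divided by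
    \<open>z powr (\<alpha> + 2)\<close>; the exponents match because (\<alpha> + 1)(\<beta> + 1) =
    \<alpha> + 2.\<close>
  let ?L = "\<lambda>z. (t * (R z / z powr (\<alpha> + 2)) - t * (G z / z powr (\<alpha> + 1)))
      / (t * (G z / z powr (\<alpha> + 1))) powr (\<beta> + 1)"
  have \<beta>: "\<beta> > 0" "(\<alpha> + 1) * (\<beta> + 1) = \<alpha> + 2" "\<alpha> + 1 = 1 / \<beta>" "\<alpha> + 2 = (\<beta> + 1) / \<beta>"
    using \<open>\<alpha> \<ge> 0\<close> by (auto simp: \<beta>_def field_simps)
  have "((\<lambda>z. ?L z) \<longlongrightarrow> (t * (N / (\<alpha> + 1) / (\<alpha> + 2)) - t * (N / (\<alpha> + 1)))
      / (t * (N / (\<alpha> + 1))) powr (\<beta> + 1)) (at_right 0)"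
    using assms(2-4) by (intro tendsto_intros limG limR) auto
  also have "(t * (N / (\<alpha> + 1) / (\<alpha> + 2)) - t * (N / (\<alpha> + 1))) / (t * (N / (\<alpha> + 1))) powr (\<beta> + 1)
      = - ((t * N * \<beta>) powr - \<beta> / (\<beta> + 1))"
  proof -
    \<comment> \<open>\<open>y\<close> is the limit of \<open>h / z powr (\<alpha> + 1)\<close>.
      Since 1 / (\<alpha> + 2) = \<beta> / (\<beta> + 1), the numerator tends to - y / (\<beta> +
      1).\<close>
    define y where "y = t * N * \<beta>"
    have "y > 0" using assms(2,4) \<beta> by (simp add: y_def)
    have "(t * (N / (\<alpha> + 1) / (\<alpha> + 2)) - t * (N / (\<alpha> + 1))) = y * (\<beta> / (\<beta> + 1) - 1)"
      unfolding \<beta>(3,4) y_def using \<beta>(1) by (simp add: field_simps)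
    moreover have "\<beta> / (\<beta> + 1) - 1 = - (1 / (\<beta> + 1))" using \<beta>(1) by (simp add: field_simps)
    moreover have "t * (N / (\<alpha> + 1)) = y" unfolding \<beta>(3) y_def by simp
    moreover have "y / y powr (\<beta> + 1) = y powr - \<beta>"
      using \<open>y > 0\<close> by (simp add: powr_add powr_minus field_simps)
    ultimately show ?thesis unfolding y_def[symmetric]
      by (metis (no_types, opaque_lifting) mult_minus_right times_divide_eq_left mult.right_neutral times_divide_eq_right minus_divide_left)
  qed
  finally have "((\<lambda>h. ?L (?z h)) \<longlongrightarrow> - ((t * N * \<beta>) powr - \<beta> / (\<beta> + 1))) (at_right 0)"
    by (rule filterlim_compose[OF _ gap])
  moreover have "\<forall>\<^sub>F h in at_right 0. ?L (?z h) = F_fun f (\<sigma> * h) t c / h powr (\<beta> + 1)"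
    using eventually_gap_less[OF \<sigma> \<open>t > 0\<close> zero_less_one, of c] pos
  proof eventually_elim
    case (elim h)
    define z where "z = ?z h"
    have z: "z > 0" and u: "u_fun f (\<sigma> * h) t c = c - \<sigma> * z"
      using elim \<sigma> by (auto simp: z_def gap_def)
    have h: "h = t * G z" using elim \<sigma> unfolding u G_def by (auto simp: algebra_simps)
    have F: "F_fun f (\<sigma> * h) t c = t * R z - h * z"
    proof -
      have "\<sigma> * h = t * (deriv f c - deriv f (c - \<sigma> * z))" using elim unfolding u by blast
      from F_fun_eq[OF \<open>t > 0\<close> this] show ?thesis
        using \<sigma> by (auto simp: R_def algebra_simps)
    qed
    have "(t * (G z / z powr (\<alpha> + 1))) powr (\<beta> + 1) = (h / z powr (\<alpha> + 1)) powr (\<beta> + 1)"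
      by (simp add: h)
    also have "\<dots> = h powr (\<beta> + 1) / z powr (\<alpha> + 2)"
      using elim z by (simp add: powr_divide powr_powr \<beta>(2))
    finally have D: "(t * (G z / z powr (\<alpha> + 1))) powr (\<beta> + 1) = h powr (\<beta> + 1) / z powr (\<alpha> + 2)" .
    have "z powr (\<alpha> + 2) = z powr (\<alpha> + 1) * z"
      using z powr_add[of z "\<alpha> + 1" 1] by (simp add: add.assoc)
    then have "t * (R z / z powr (\<alpha> + 2)) - t * (G z / z powr (\<alpha> + 1)) = F_fun f (\<sigma> * h) t c / z powr (\<alpha> + 2)"
      unfolding F using z by (simp add: h field_simps)
    then show ?case unfolding z_def[symmetric] D using z by simp
  qed
  ultimately show ?thesis by (rule Lim_transform_eventually)
qed

end

section \<open>Lifespans as suprema\<close>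

lemma side_1: "side 1 = at_right 0"
  by (simp add: side_def filter_eq_iff eventually_filtermap)

lemma side_minus_1: "side (-1) = at_left 0"
  by (simp add: side_def at_left_minus[of "0::real"] filter_eq_iff eventually_filtermap)

text \<open>The common form of \<open>tp_plus\<close> and \<open>tp_minus\<close>, so that every
  argument is given once for both signs.\<close>

definition lifespan :: "(real \<Rightarrow> real) \<Rightarrow> (real \<Rightarrow> real) \<Rightarrow> real \<Rightarrow> real \<Rightarrow> real \<Rightarrow> ennreal" where
  "lifespan f \<phi> \<sigma> x0 c =
     Sup {ennreal t | t. t > 0 \<and> (\<forall>\<^sub>F l in side \<sigma>. F_fun f l t c < Phi \<phi> l x0 c)}"

lemma tp_plus_eq_lifespan: "tp_plus f \<phi> x0 c = lifespan f \<phi> 1 x0 c"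
  by (simp add: tp_plus_def lifespan_def side_1)

lemma tp_minus_eq_lifespan: "tp_minus f \<phi> x0 c = lifespan f \<phi> (-1) x0 c"
  by (simp add: tp_minus_def lifespan_def side_minus_1)

lemma lifespan_ge:
  assumes "t > 0" and "\<forall>\<^sub>F l in side \<sigma>. F_fun f l t c < Phi \<phi> l x0 c"
  shows "ennreal t \<le> lifespan f \<phi> \<sigma> x0 c"
  unfolding lifespan_def using assms by (intro Sup_upper) auto

lemma lifespan_le:
  assumes "\<And>t. t > T \<Longrightarrow> t > 0 \<Longrightarrow> \<not> (\<forall>\<^sub>F l in side \<sigma>. F_fun f l t c < Phi \<phi> l x0 c)"
  shows "lifespan f \<phi> \<sigma> x0 c \<le> ennreal T"
  unfolding lifespan_def
proof (rule Sup_least, clarify)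
  fix t assume "t > 0" "\<forall>\<^sub>F l in side \<sigma>. F_fun f l t c < Phi \<phi> l x0 c"
  then have "t \<le> T" using assms[of t] by (meson not_le)
  then show "ennreal t \<le> ennreal T" by (rule ennreal_leI)
qed

text \<open>Lower bounds for a lifespan are available only strictly below the critical time; density
  of the order passes to the critical time itself.\<close>

lemma ennreal_le_of_less:
  assumes "\<And>t. 0 < t \<Longrightarrow> t < T \<Longrightarrow> ennreal t \<le> L"
  shows "ennreal T \<le> L"
proof (cases "T > 0")
  case True
  show ?thesis
  proof (rule dense_le)
    fix y assume "y < ennreal T"
    then obtain r where r: "y = ennreal r" "0 \<le> r" "r < T"
      by (cases y) (auto simp: ennreal_less_iff)
    \<comment> \<open>The midpoint is positive even if \<open>r = 0\<close>, as the assumption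
      demands.\<close>
    have "ennreal r \<le> ennreal ((r + T) / 2)" using r by (intro ennreal_leI) auto
    also have "\<dots> \<le> L" using r by (intro assms) auto
    finally show "y \<le> L" using r by simp
  qed
qed (simp add: ennreal_neg)

lemma lifespan_top:
  assumes "\<And>t. t > 0 \<Longrightarrow> \<forall>\<^sub>F l in side \<sigma>. F_fun f l t c < Phi \<phi> l x0 c"
  shows "lifespan f \<phi> \<sigma> x0 c = \<infinity>"
proof -
  have "of_nat n \<le> lifespan f \<phi> \<sigma> x0 c" for n
  proof -
    \<comment> \<open>The successor provides a positive time also for \<open>n = 0\<close>.\<close>
    have "ennreal (real n) \<le> ennreal (real (Suc n))" by (intro ennreal_leI) simp
    also have "\<dots> \<le> lifespan f \<phi> \<sigma> x0 c" by (intro lifespan_ge assms) simp_all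
    finally show ?thesis by (simp add: ennreal_of_nat_eq_real_of_nat)
  qed
  then have "\<not> lifespan f \<phi> \<sigma> x0 c < \<infinity>"
    using ennreal_Ex_less_of_nat[of "lifespan f \<phi> \<sigma> x0 c"] by (auto simp: not_le[symmetric])
  then show ?thesis by (simp add: less_top[symmetric])
qed

section \<open>Comparison of power laws\<close>

lemma eventually_less_if_tendsto_powr:
  fixes P Q :: "real \<Rightarrow> real"
  assumes P: "((\<lambda>h. P h / h powr p) \<longlongrightarrow> a) (at_right 0)"
    and Q: "((\<lambda>h. Q h / h powr p) \<longlongrightarrow> b) (at_right 0)"
    and "a < b"
  shows "\<forall>\<^sub>F h in at_right 0. P h < Q h"
proof -
  have "((\<lambda>h. Q h / h powr p - P h / h powr p) \<longlongrightarrow> b - a) (at_right 0)"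
    by (intro tendsto_diff P Q)
  then have "\<forall>\<^sub>F h in at_right 0. 0 < Q h / h powr p - P h / h powr p"
    using \<open>a < b\<close> by (intro order_tendstoD(1)) auto
  then show ?thesis using eventually_at_right_less[of "0::real"]
    by eventually_elim (simp add: diff_divide_distrib[symmetric] zero_less_divide_iff)
qed

text \<open>The smaller exponent leaves a factor \<open>h powr (p - q)\<close> that tends to 0: a
  term of higher order is negligible at the scale of the lower one.\<close>

lemma tendsto_divide_powr_less:
  fixes P :: "real \<Rightarrow> real"
  assumes "((\<lambda>h. P h / h powr p) \<longlongrightarrow> a) (at_right 0)" and "q < p"
  shows "((\<lambda>h. P h / h powr q) \<longlongrightarrow> 0) (at_right 0)"
proof -
  have "((\<lambda>h::real. h powr (p - q)) \<longlongrightarrow> 0) (at_right 0)"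
    using assms(2) by (intro tendsto_zero_powrI[where b = "p - q"] tendsto_intros)
      (auto intro: eventually_mono[OF eventually_at_right_less])
  then have "((\<lambda>h. P h / h powr p * h powr (p - q)) \<longlongrightarrow> a * 0) (at_right 0)"
    by (intro tendsto_mult assms(1))
  moreover have "\<forall>\<^sub>F h in at_right 0. P h / h powr p * h powr (p - q) = P h / h powr q"
    using eventually_at_right_less[of "0::real"]
    by eventually_elim (simp add: powr_diff)
  ultimately show ?thesis by (simp add: tendsto_cong)
qed

section \<open>Dini derivatives and the sign of \<open>Phi\<close>\<close>

text \<open>Subtracting the constant \<open>c\<close> from the integrand lowers its mean by
  \<open>c\<close>, for either sign of \<open>l\<close>. This relates the Dini quotients to
  \<open>Phi\<close>.\<close>

lemma mean_eq_Phi: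
  assumes int: "\<And>a b. \<phi> absolutely_integrable_on {a..b}" and "l \<noteq> 0"
  shows "1 / l * (LINT \<xi>=ereal x0..ereal (x0 + l)|lebesgue. \<phi> \<xi>) = c + Phi \<phi> l x0 c / l"
proof -
  have d: "(\<lambda>\<xi>. \<phi> \<xi> - c) absolutely_integrable_on {a..b}" for a b
    using int by (intro set_integral_diff absolutely_integrable_on_const) auto
  have *: "integral {a..b} (\<lambda>\<xi>. \<phi> \<xi> - c) = integral {a..b} \<phi> - c * (b - a)" if "a \<le> b" for a b
    using that set_lebesgue_integral_eq_integral(1)[OF int]
    by (subst Henstock_Kurzweil_Integration.integral_diff) auto
  show ?thesis
    using \<open>l \<noteq> 0\<close> by (cases "l > 0")
      (simp_all add: Phi_def interval_lebesgue_integral_eq_integral[OF int]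
        interval_lebesgue_integral_eq_integral[OF d] * field_simps)
qed

lemma eventually_Phi_pos_right:
  assumes int: "\<And>a b. \<phi> absolutely_integrable_on {a..b}" and "ereal c < lower_right_D \<phi> x0"
  shows "\<forall>\<^sub>F l in side 1. 0 < Phi \<phi> l x0 c"
proof -
  have "\<forall>\<^sub>F l in at_right 0. ereal c < ereal (1 / l * (LINT \<xi>=ereal x0..ereal (x0 + l)|lebesgue. \<phi> \<xi>))"
    using assms(2) unfolding lower_right_D_def by (rule less_LiminfD)
  then show ?thesis unfolding side_1 using eventually_at_right_less[of 0]
    by eventually_elim (simp add: mean_eq_Phi[OF int, where c = c] zero_less_divide_iff del: times_divide_eq_left mult_1)
qed

text \<open>For \<open>l < 0\<close> a mean below \<open>c\<close> means that \<open>Phi / l\<close>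
  is negative, hence \<open>Phi\<close> positive; this is why an upper derivative enters on the
  left.\<close>

lemma eventually_Phi_pos_left:
  assumes int: "\<And>a b. \<phi> absolutely_integrable_on {a..b}" and "upper_left_D \<phi> x0 < ereal c"
  shows "\<forall>\<^sub>F l in side (-1). 0 < Phi \<phi> l x0 c"
proof -
  have "\<forall>\<^sub>F l in at_left 0. ereal (1 / l * (LINT \<xi>=ereal x0..ereal (x0 + l)|lebesgue. \<phi> \<xi>)) < ereal c"
    using assms(2) unfolding upper_left_D_def by (rule Limsup_lessD)
  moreover have "\<forall>\<^sub>F l in at_left (0::real). l < 0" by (auto simp: eventually_at_filter)
  ultimately show ?thesis unfolding side_minus_1
    by eventually_elim (simp add: mean_eq_Phi[OF int, where c = c] divide_less_0_iff del: times_divide_eq_left mult_1)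
qed

section \<open>Lifespans of characteristics\<close>

context strictly_convex_flux
begin

text \<open>\<open>F_fun\<close> is nonpositive near 0 for every \<open>t > 0\<close>, so a positive
  \<open>Phi\<close> stays above it at all times.\<close>

lemma lifespan_eq_top_if_Phi_pos:
  assumes \<sigma>: "\<sigma> = 1 \<or> \<sigma> = -1" and "\<forall>\<^sub>F l in side \<sigma>. 0 < Phi \<phi> l x0 c"
  shows "lifespan f \<phi> \<sigma> x0 c = \<infinity>"
proof (rule lifespan_top)
  fix t :: real assume "t > 0"
  show "\<forall>\<^sub>F l in side \<sigma>. F_fun f l t c < Phi \<phi> l x0 c"
    using assms(2) eventually_F_fun_nonpos[OF \<sigma> \<open>t > 0\<close>, of c] by eventually_elim linarith
qed

lemma eventually_F_le_Phi:
  assumes "L_infinity \<phi>" and "c \<in> char_set f \<phi> x0"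
  obtains t where "t > 0"
    and "\<And>\<sigma>. \<sigma> = 1 \<or> \<sigma> = -1 \<Longrightarrow> \<forall>\<^sub>F l in side \<sigma>. F_fun f l t c \<le> Phi \<phi> l x0 c"
proof -
  obtain t where t: "t > 0"
    "\<And>u l. l = t * (deriv f c - deriv f u) \<Longrightarrow> F_fun f l t c \<le> Phi \<phi> l x0 c"
    using char_set_F_le_Phi[OF assms] by blast
  have "\<forall>\<^sub>F l in side \<sigma>. F_fun f l t c \<le> Phi \<phi> l x0 c" if "\<sigma> = 1 \<or> \<sigma> = -1" for \<sigma>
    using eventually_u_fun[OF that \<open>t > 0\<close>, of c] by eventually_elim (use t(2) in blast)
  then show thesis using that t(1) by blast
qed

text \<open>The maximizer property gives only a weak inequality at its time \<open>t\<close>; strict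
  monotonicity of \<open>F_fun\<close> in time makes it strict at \<open>t / 2\<close>.\<close>

lemma lifespan_pos:
  assumes "L_infinity \<phi>" and "c \<in> char_set f \<phi> x0" and \<sigma>: "\<sigma> = 1 \<or> \<sigma> = -1"
  shows "0 < lifespan f \<phi> \<sigma> x0 c"
proof -
  obtain t where "t > 0" and le: "\<forall>\<^sub>F l in side \<sigma>. F_fun f l t c \<le> Phi \<phi> l x0 c"
    using eventually_F_le_Phi[OF assms(1,2)] \<sigma> by blast
  have "\<forall>\<^sub>F l in side \<sigma>. F_fun f l (t / 2) c < F_fun f l t c"
    using \<open>t > 0\<close> by (intro eventually_F_fun_strict_mono \<sigma>) auto
  with le have "\<forall>\<^sub>F l in side \<sigma>. F_fun f l (t / 2) c < Phi \<phi> l x0 c"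
    by eventually_elim linarith
  then have "ennreal (t / 2) \<le> lifespan f \<phi> \<sigma> x0 c" using \<open>t > 0\<close> by (intro lifespan_ge) auto
  then show ?thesis using \<open>t > 0\<close> by (metis ennreal_less_zero_iff half_gt_zero order_less_le_trans)
qed

text \<open>Dividing \<open>l * (u_fun f l t c - c) \<le> Phi \<phi> l x0 c\<close> by
  \<open>l\<close> bounds the mean of \<open>\<phi>\<close> by \<open>u_fun\<close>, from below on
  the right and from above on the left, and \<open>u_fun\<close> tends to \<open>c\<close>.\<close>

lemma Dini_bounds:
  assumes "L_infinity \<phi>" and "c \<in> char_set f \<phi> x0"
  shows "upper_left_D \<phi> x0 \<le> ereal c" and "ereal c \<le> lower_right_D \<phi> x0"
proof -
  obtain t where "t > 0"
    and le: "\<And>\<sigma>. \<sigma> = 1 \<or> \<sigma> = -1 \<Longrightarrow> \<forall>\<^sub>F l in side \<sigma>. F_fun f l t c \<le> Phi \<phi> l x0 c"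
    using eventually_F_le_Phi[OF assms] by blast
  note mean = mean_eq_Phi[OF L_infinity_absolutely_integrable[OF assms(1)], where c = c]
  have u: "((\<lambda>l. ereal (u_fun f l t c)) \<longlongrightarrow> ereal c) (side \<sigma>)" if "\<sigma> = 1 \<or> \<sigma> = -1" for \<sigma>
    using tendsto_u_fun[OF that \<open>t > 0\<close>] by simp
  have ge: "\<forall>\<^sub>F l in side \<sigma>. l * (u_fun f l t c - c) \<le> Phi \<phi> l x0 c" if "\<sigma> = 1 \<or> \<sigma> = -1" for \<sigma>
    using le[OF that] eventually_F_fun_ge[OF that \<open>t > 0\<close>, of c] by eventually_elim linarith
  have "ereal c = Liminf (at_right 0) (\<lambda>l. ereal (u_fun f l t c))"
    using lim_imp_Liminf[OF _ u[of 1]] by (simp add: side_1)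
  also have "\<dots> \<le> lower_right_D \<phi> x0"
    unfolding lower_right_D_def
  proof (rule Liminf_mono)
    show "\<forall>\<^sub>F l in at_right 0. ereal (u_fun f l t c)
        \<le> ereal (1 / l * (LINT \<xi>=ereal x0..ereal (x0 + l)|lebesgue. \<phi> \<xi>))"
      using ge[of 1, simplified side_1, simplified] eventually_at_right_less[of 0]
    proof eventually_elim
      case (elim l)
      then have "u_fun f l t c \<le> c + Phi \<phi> l x0 c / l" by (simp add: field_simps)
      then show ?case using mean[of l x0] elim by simp
    qed
  qed
  finally show "ereal c \<le> lower_right_D \<phi> x0" .
  have "upper_left_D \<phi> x0 \<le> Limsup (at_left 0) (\<lambda>l. ereal (u_fun f l t c))"
    unfolding upper_left_D_def
  proof (rule Limsup_mono)
    have "\<forall>\<^sub>F l in at_left (0::real). l < 0" by (auto simp: eventually_at_filter)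
    with ge[of "-1", simplified side_minus_1, simplified]
    show "\<forall>\<^sub>F l in at_left 0. ereal (1 / l * (LINT \<xi>=ereal x0..ereal (x0 + l)|lebesgue. \<phi> \<xi>))
        \<le> ereal (u_fun f l t c)"
    proof eventually_elim
      case (elim l)
      then have "c + Phi \<phi> l x0 c / l \<le> u_fun f l t c" by (simp add: field_simps)
      then show ?case using mean[of l x0] elim by simp
    qed
  qed
  also have "\<dots> = ereal c"
    using lim_imp_Limsup[OF _ u[of "-1"]] by (simp add: side_minus_1)
  finally show "upper_left_D \<phi> x0 \<le> ereal c" .
qed

text \<open>The leading terms of \<open>Phi\<close> and \<open>F_fun\<close> have exponents \<gamma>
  + 1 and \<beta> + 1. For negative \<open>C\<close> the smaller exponent dominates: the lifespan is
  infinite for \<gamma> > \<beta> and 0 for \<gamma> < \<beta>, while for \<gamma> = \<beta> the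
  coefficients decide.\<close>

lemma lifespan_asymp:
  assumes \<sigma>: "\<sigma> = 1 \<or> \<sigma> = -1" and int: "\<And>a b. \<phi> absolutely_integrable_on {a..b}"
    and "\<alpha> \<ge> 0" and "\<gamma> > 0" and "N > 0" and "C \<noteq> 0"
    and flux: "flux_asymp f c (filtermap (\<lambda>z. c - \<sigma> * z) (at_right 0)) N \<alpha>"
    and data: "data_asymp \<phi> x0 c (side \<sigma>) C \<gamma>"
  defines "T \<equiv> lifespan f \<phi> \<sigma> x0 c"
  shows "(0 < T \<and> T < \<infinity> \<longleftrightarrow> C < 0 \<and> \<gamma> * (1 + \<alpha>) = 1) \<and>
    (0 < T \<and> T < \<infinity> \<longrightarrow> T = ennreal (inverse (\<gamma> * N * \<bar>C\<bar> powr (1 + \<alpha>))) \<and>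
      (\<forall>t. ennreal t > T \<longrightarrow> (\<forall>\<^sub>F l in side \<sigma>. Phi \<phi> l x0 c < F_fun f l t c)))"
proof -
  define \<beta> where "\<beta> = 1 / (1 + \<alpha>)"
  define K where "K t = (t * N * \<beta>) powr - \<beta> / (\<beta> + 1)" for t
  have "\<beta> > 0" using \<open>\<alpha> \<ge> 0\<close> by (simp add: \<beta>_def)
  have P: "((\<lambda>h. Phi \<phi> (\<sigma> * h) x0 c / h powr (\<gamma> + 1)) \<longlongrightarrow> C / (\<gamma> + 1)) (at_right 0)"
    using tendsto_Phi[OF int \<sigma> \<open>\<gamma> > 0\<close> data[unfolded side_def]] .
  have F: "((\<lambda>h. F_fun f (\<sigma> * h) t c / h powr (\<beta> + 1)) \<longlongrightarrow> - K t) (at_right 0)" if "t > 0" for t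
    using tendsto_F_fun[OF \<sigma> that \<open>\<alpha> \<ge> 0\<close> \<open>N > 0\<close> flux] by (simp add: \<beta>_def K_def)
  have K_pos: "K t > 0" if "t > 0" for t
    using that \<open>N > 0\<close> \<open>\<beta> > 0\<close> by (simp add: K_def)
  have not_both: "\<not> (\<forall>\<^sub>F l in side \<sigma>. F_fun f l t c < Phi \<phi> l x0 c)"
    if "\<forall>\<^sub>F l in side \<sigma>. Phi \<phi> l x0 c < F_fun f l t c" for t
  proof
    assume "\<forall>\<^sub>F l in side \<sigma>. F_fun f l t c < Phi \<phi> l x0 c"
    with that have "\<forall>\<^sub>F l in side \<sigma>. False" by eventually_elim linarith
    \<comment> \<open>The one-sided filter is proper, so False cannot hold eventually.\<close>
    then show False by (simp add: side_def eventually_filtermap)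
  qed
  note * = eventually_less_if_tendsto_powr
  consider "C > 0" | "C < 0" "\<gamma> > \<beta>" | "C < 0" "\<gamma> < \<beta>" | "C < 0" "\<gamma> = \<beta>"
    using \<open>C \<noteq> 0\<close> by linarith
  then show ?thesis
  proof cases
    case 1
    have "\<forall>\<^sub>F l in side \<sigma>. 0 < Phi \<phi> l x0 c"
      unfolding side_def eventually_filtermap
      by (rule *[where P = "\<lambda>_. 0", OF _ P]) (use 1 \<open>\<gamma> > 0\<close> in auto)
    then have "T = \<infinity>" unfolding T_def by (rule lifespan_eq_top_if_Phi_pos[OF \<sigma>])
    with 1 show ?thesis by simp
  next
    case 2
    have "T = \<infinity>" unfolding T_def
    proof (rule lifespan_top)
      fix t :: real assume "t > 0"
      show "\<forall>\<^sub>F l in side \<sigma>. F_fun f l t c < Phi \<phi> l x0 c"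
        unfolding side_def eventually_filtermap
        by (rule *[OF F[OF \<open>t > 0\<close>] tendsto_divide_powr_less[OF P]]) (use 2 K_pos[OF \<open>t > 0\<close>] in auto)
    qed
    moreover have "\<gamma> * (1 + \<alpha>) \<noteq> 1" using 2 \<open>\<alpha> \<ge> 0\<close> by (auto simp: \<beta>_def field_simps)
    ultimately show ?thesis by simp
  next
    case 3
    \<comment> \<open>Here \<open>F_fun\<close> is of higher order than the negative
      \<open>Phi\<close>, so no positive time is admissible and the supremum is 0.\<close>
    have "T \<le> ennreal 0" unfolding T_def
    proof (rule lifespan_le, rule not_both)
      fix t :: real assume "t > 0"
      show "\<forall>\<^sub>F l in side \<sigma>. Phi \<phi> l x0 c < F_fun f l t c"
        unfolding side_def eventually_filtermap
        by (rule *[OF P tendsto_divide_powr_less[OF F[OF \<open>t > 0\<close>]]])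
          (use 3 \<open>\<gamma> > 0\<close> in \<open>auto simp: divide_less_0_iff\<close>)
    qed
    moreover have "\<gamma> * (1 + \<alpha>) \<noteq> 1" using 3 \<open>\<alpha> \<ge> 0\<close> by (auto simp: \<beta>_def field_simps)
    ultimately show ?thesis by simp
  next
    case 4
    \<comment> \<open>\<open>T0\<close> is the time at which the leading coefficients agree:
      \<open>K T0 = - C / (\<beta> + 1)\<close>, solved with 1 / \<beta> = 1 + \<alpha>.\<close>
    define T0 where "T0 = inverse (\<gamma> * N * \<bar>C\<bar> powr (1 + \<alpha>))"
    have "T0 > 0" using 4 \<open>\<gamma> > 0\<close> \<open>N > 0\<close> by (simp add: T0_def)
    have inv: "1 + \<alpha> = 1 / \<beta>" using \<open>\<alpha> \<ge> 0\<close> by (simp add: \<beta>_def)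
    have T0: "T0 * N * \<beta> = \<bar>C\<bar> powr - (1 / \<beta>)"
      using 4 \<open>N > 0\<close> \<open>\<beta> > 0\<close> by (simp add: T0_def inv powr_minus field_simps)
    have K_T0: "K T0 = - C / (\<beta> + 1)"
      unfolding K_def T0 using 4 \<open>\<beta> > 0\<close> by (simp add: powr_powr)
    have K_anti: "K t < K s" if "0 < s" "s < t" for s t
      unfolding K_def using that \<open>N > 0\<close> \<open>\<beta> > 0\<close>
      by (intro divide_strict_right_mono powr_less_mono2_neg) auto
    have before: "\<forall>\<^sub>F l in side \<sigma>. F_fun f l t c < Phi \<phi> l x0 c" if "0 < t" "t < T0" for t
      unfolding side_def eventually_filtermap
      by (rule *[OF F[OF \<open>t > 0\<close>] P[unfolded 4(2)]]) (use K_anti[OF that] K_T0 in simp)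
    have after: "\<forall>\<^sub>F l in side \<sigma>. Phi \<phi> l x0 c < F_fun f l t c" if "T0 < t" for t
      unfolding side_def eventually_filtermap
      by (rule *[OF P[unfolded 4(2)] F]) (use K_anti[OF \<open>T0 > 0\<close> that] K_T0 that \<open>T0 > 0\<close> in simp_all)
    \<comment> \<open>Leading coefficients say nothing at \<open>t = T0\<close> itself; the times on
      either side determine the supremum.\<close>
    have "ennreal T0 \<le> T" unfolding T_def
      by (rule ennreal_le_of_less) (intro lifespan_ge before)
    moreover have "T \<le> ennreal T0" unfolding T_def
      by (rule lifespan_le) (intro not_both after)
    ultimately have T: "T = ennreal T0" by simp
    have "0 < T" "T < \<infinity>" using \<open>T0 > 0\<close> by (simp_all add: T)
    moreover have "\<gamma> * (1 + \<alpha>) = 1" unfolding inv 4(2) using \<open>\<beta> > 0\<close> by simp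
    moreover have "\<forall>\<^sub>F l in side \<sigma>. Phi \<phi> l x0 c < F_fun f l t c" if "ennreal t > T" for t
      using that \<open>T0 > 0\<close> by (intro after) (simp add: T ennreal_less_iff)
    ultimately show ?thesis using 4 T by (simp add: T0_def)
  qed
qed

text \<open>The sides cross: \<open>l > 0\<close> puts \<open>u_fun\<close> below \<open>c\<close>,
  so data to the right of \<open>x0\<close> are paired with the flux to the left of
  \<open>c\<close>.\<close>

lemma lifespan_asymp_plus:
  assumes "L_infinity \<phi>" and "\<alpha> \<ge> 0 \<and> \<gamma> > 0 \<and> N > 0 \<and> C \<noteq> 0"
    and "flux_asymp f c (at_left c) N \<alpha>" and "data_asymp \<phi> x0 c (at_right 0) C \<gamma>"
  defines "T \<equiv> tp_plus f \<phi> x0 c"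
  shows "(0 < T \<and> T < \<infinity> \<longleftrightarrow> C < 0 \<and> \<gamma> * (1 + \<alpha>) = 1) \<and>
    (0 < T \<and> T < \<infinity> \<longrightarrow> T = ennreal (inverse (\<gamma> * N * \<bar>C\<bar> powr (1 + \<alpha>))) \<and>
      (\<forall>t. ennreal t > T \<longrightarrow> (\<forall>\<^sub>F l in at_right 0. Phi \<phi> l x0 c < F_fun f l t c)))"
proof -
  have eq: "filtermap (\<lambda>z. c - 1 * z) (at_right 0) = at_left c"
    unfolding at_left_minus[of c] at_right_to_0[of "-c"] filtermap_filtermap by simp
  show ?thesis
    unfolding T_def tp_plus_eq_lifespan
    by (rule lifespan_asymp[where \<sigma> = 1, unfolded side_1])
      (use assms L_infinity_absolutely_integrable eq in auto)
qed

lemma lifespan_asymp_minus: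
  assumes "L_infinity \<phi>" and "\<alpha> \<ge> 0 \<and> \<gamma> > 0 \<and> N > 0 \<and> C \<noteq> 0"
    and "flux_asymp f c (at_right c) N \<alpha>" and "data_asymp \<phi> x0 c (at_left 0) C \<gamma>"
  defines "T \<equiv> tp_minus f \<phi> x0 c"
  shows "(0 < T \<and> T < \<infinity> \<longleftrightarrow> C < 0 \<and> \<gamma> * (1 + \<alpha>) = 1) \<and>
    (0 < T \<and> T < \<infinity> \<longrightarrow> T = ennreal (inverse (\<gamma> * N * \<bar>C\<bar> powr (1 + \<alpha>))) \<and>
      (\<forall>t. ennreal t > T \<longrightarrow> (\<forall>\<^sub>F l in at_left 0. Phi \<phi> l x0 c < F_fun f l t c)))"
proof -
  have eq: "filtermap (\<lambda>z. c - (-1) * z) (at_right 0) = at_right c"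
    unfolding at_right_to_0[of c] by (simp add: add.commute)
  show ?thesis
    unfolding T_def tp_minus_eq_lifespan
    by (rule lifespan_asymp[where \<sigma> = "-1", unfolded side_minus_1])
      (use assms L_infinity_absolutely_integrable eq in auto)
qed

end

section \<open>Combination of the two sides\<close>

theorem theorem3p12:
  fixes f \<phi> :: "real \<Rightarrow> real" and x0 :: real
  assumes "C2 f"
    and "\<And>s. deriv (deriv f) s \<ge> 0"
    and "{s. deriv (deriv f) s = 0} \<in> null_sets lebesgue"
    and "L_infinity \<phi>"
    and "char_set f \<phi> x0 \<noteq> {}"
  shows
    "(upper_left_D \<phi> x0 < lower_right_D \<phi> x0 \<or> upper_left_D \<phi> x0 = lower_right_D \<phi> x0) \<and>
     (\<forall>c \<in> char_set f \<phi> x0.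
        tp_plus f \<phi> x0 c > 0 \<and> tp_minus f \<phi> x0 c > 0 \<and>
        (upper_left_D \<phi> x0 < lower_right_D \<phi> x0 \<longrightarrow>
           (upper_left_D \<phi> x0 < ereal c \<and> ereal c < lower_right_D \<phi> x0 \<longrightarrow>
              tp f \<phi> x0 c = \<infinity> \<and> tp_plus f \<phi> x0 c = \<infinity> \<and> tp_minus f \<phi> x0 c = \<infinity>) \<and>
           (ereal c = upper_left_D \<phi> x0 \<longrightarrow>
              tp_plus f \<phi> x0 c = \<infinity> \<and>
              (\<forall>\<alpha>p \<gamma>m Np Cm :: real.
                 \<alpha>p \<ge> 0 \<and> \<gamma>m > 0 \<and> Np > 0 \<and> Cm \<noteq> 0 \<and>
                 flux_asymp f c (at_right c) Np \<alpha>p \<and>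
                 data_asymp \<phi> x0 c (at_left 0) Cm \<gamma>m \<longrightarrow>
                   (0 < tp_minus f \<phi> x0 c \<and> tp_minus f \<phi> x0 c < \<infinity> \<longleftrightarrow>
                      Cm < 0 \<and> \<gamma>m * (1 + \<alpha>p) = 1) \<and>
                   (0 < tp_minus f \<phi> x0 c \<and> tp_minus f \<phi> x0 c < \<infinity> \<longrightarrow>
                      tp_minus f \<phi> x0 c = ennreal (inverse (\<gamma>m * Np * \<bar>Cm\<bar> powr (1 + \<alpha>p))) \<and>
                      (\<forall>t::real. ennreal t > tp_minus f \<phi> x0 c \<longrightarrow>
                         (\<forall>\<^sub>F l in at_left 0. Phi \<phi> l x0 c < F_fun f l t c))))) \<and>
           (ereal c = lower_right_D \<phi> x0 \<longrightarrow>
              tp_minus f \<phi> x0 c = \<infinity> \<and>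
              (\<forall>\<alpha>m \<gamma>p Nm Cp :: real.
                 \<alpha>m \<ge> 0 \<and> \<gamma>p > 0 \<and> Nm > 0 \<and> Cp \<noteq> 0 \<and>
                 flux_asymp f c (at_left c) Nm \<alpha>m \<and>
                 data_asymp \<phi> x0 c (at_right 0) Cp \<gamma>p \<longrightarrow>
                   (0 < tp_plus f \<phi> x0 c \<and> tp_plus f \<phi> x0 c < \<infinity> \<longleftrightarrow>
                      Cp < 0 \<and> \<gamma>p * (1 + \<alpha>m) = 1) \<and>
                   (0 < tp_plus f \<phi> x0 c \<and> tp_plus f \<phi> x0 c < \<infinity> \<longrightarrow>
                      tp_plus f \<phi> x0 c = ennreal (inverse (\<gamma>p * Nm * \<bar>Cp\<bar> powr (1 + \<alpha>m))) \<and>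
                      (\<forall>t::real. ennreal t > tp_plus f \<phi> x0 c \<longrightarrow>
                         (\<forall>\<^sub>F l in at_right 0. Phi \<phi> l x0 c < F_fun f l t c)))))) \<and>
        (upper_left_D \<phi> x0 = lower_right_D \<phi> x0 \<longrightarrow>
           (\<forall>\<alpha>p \<alpha>m \<gamma>p \<gamma>m Np Nm Cp Cm :: real.
              \<alpha>p \<ge> 0 \<and> \<alpha>m \<ge> 0 \<and> \<gamma>p > 0 \<and> \<gamma>m > 0 \<and> Np > 0 \<and> Nm > 0 \<and> Cp \<noteq> 0 \<and> Cm \<noteq> 0 \<and>
              flux_asymp f c (at_right c) Np \<alpha>p \<and> flux_asymp f c (at_left c) Nm \<alpha>m \<and>
              data_asymp \<phi> x0 c (at_right 0) Cp \<gamma>p \<and> data_asymp \<phi> x0 c (at_left 0) Cm \<gamma>m \<longrightarrow>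
                (0 < tp_plus f \<phi> x0 c \<and> tp_plus f \<phi> x0 c < \<infinity> \<longleftrightarrow>
                   Cp < 0 \<and> \<gamma>p * (1 + \<alpha>m) = 1) \<and>
                (0 < tp_plus f \<phi> x0 c \<and> tp_plus f \<phi> x0 c < \<infinity> \<longrightarrow>
                   tp_plus f \<phi> x0 c = ennreal (inverse (\<gamma>p * Nm * \<bar>Cp\<bar> powr (1 + \<alpha>m))) \<and>
                   (\<forall>t::real. ennreal t > tp_plus f \<phi> x0 c \<longrightarrow>
                      (\<forall>\<^sub>F l in at_right 0. Phi \<phi> l x0 c < F_fun f l t c))) \<and>
                (0 < tp_minus f \<phi> x0 c \<and> tp_minus f \<phi> x0 c < \<infinity> \<longleftrightarrow>
                   Cm < 0 \<and> \<gamma>m * (1 + \<alpha>p) = 1) \<and>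
                (0 < tp_minus f \<phi> x0 c \<and> tp_minus f \<phi> x0 c < \<infinity> \<longrightarrow>
                   tp_minus f \<phi> x0 c = ennreal (inverse (\<gamma>m * Np * \<bar>Cm\<bar> powr (1 + \<alpha>p))) \<and>
                   (\<forall>t::real. ennreal t > tp_minus f \<phi> x0 c \<longrightarrow>
                      (\<forall>\<^sub>F l in at_left 0. Phi \<phi> l x0 c < F_fun f l t c))))))"
proof -
  interpret strictly_convex_flux f using assms(1-3) by unfold_locales auto
  note \<phi> = \<open>L_infinity \<phi>\<close>
  note int = L_infinity_absolutely_integrable[OF \<phi>]
  have plus_top: "tp_plus f \<phi> x0 c = \<infinity>" if "ereal c < lower_right_D \<phi> x0" for c
    unfolding tp_plus_eq_lifespan
    by (rule lifespan_eq_top_if_Phi_pos) (auto intro: eventually_Phi_pos_right[OF int that])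
  have minus_top: "tp_minus f \<phi> x0 c = \<infinity>" if "upper_left_D \<phi> x0 < ereal c" for c
    unfolding tp_minus_eq_lifespan
    by (rule lifespan_eq_top_if_Phi_pos) (auto intro: eventually_Phi_pos_left[OF int that])
  note asymp = lifespan_asymp_plus[OF \<phi>, THEN conjunct1] lifespan_asymp_plus[OF \<phi>, THEN conjunct2]
    lifespan_asymp_minus[OF \<phi>, THEN conjunct1] lifespan_asymp_minus[OF \<phi>, THEN conjunct2]
  show ?thesis
  proof (intro conjI ballI impI)
    obtain c where "c \<in> char_set f \<phi> x0" using assms(5) by blast
    \<comment> \<open>Any \<open>c\<close> in the characteristic set lies between the two Dini
      derivatives, so they are ordered.\<close>
    then show "upper_left_D \<phi> x0 < lower_right_D \<phi> x0 \<or> upper_left_D \<phi> x0 = lower_right_D \<phi> x0"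
      using Dini_bounds[OF \<phi>] by (meson order.trans order_le_less)
  next
    fix c assume "c \<in> char_set f \<phi> x0"
    then show "0 < tp_plus f \<phi> x0 c" and "0 < tp_minus f \<phi> x0 c"
      unfolding tp_plus_eq_lifespan tp_minus_eq_lifespan by (auto intro: lifespan_pos[OF \<phi>])
  \<comment> \<open>If \<open>c\<close> equals one Dini derivative in case (i), it is strictly
    separated from the other, which makes the lifespan on that other side infinite. The power-law
    claims of both cases are instances of the same one-sided results.\<close>
  qed ((intro allI impI; elim conjE; intro conjI asymp; assumption)
      | (simp add: tp_def plus_top minus_top))+
qed

end
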